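(* Let $n\ge1$. For any $s,t>0$, there exists a sequence of centered probability measures $\mu_k$ on $\mathbb{R}^n$ such that, as $k\to\infty$: (i) $\delta(\mu_k)=\frac{st}{2}k^{-t}\log k+o(k^{-t}\log k)$; (ii) $\mathrm{H}(\mu_k)=sk^{2-t}-\frac{st}{2}k^{-t}\log k+o(k^{-t}\log k)$; (iii) $W_2^2(\mu_k,\gamma)=2sk^{2-t}+O\big(k^{1-t}(\log k)^{1/2}\big)$; (iv) $m_2(\mu_k)-m_2(\gamma)=2sk^{2-t}+\frac{s}{4}m_2(\gamma)k^{-t}+o(k^{-t})$; (v) $sk^{p-t}+o(k^{p-t})\le m_p(\mu_k)-m_p(\gamma)\le 2^{2(p-1)}sk^{p-t}+o(k^{p-t})$ for any $p\in[1,\infty)$.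
   Context: $d\gamma=(2\pi)^{-n/2}e^{-|x|^2/2}\,dx$ is the standard Gaussian measure on $\mathbb{R}^n$. For a probability measure $d\mu=f\,d\gamma$ with $f\ge 0$ in $L^1(d\gamma)$, the Fisher information and relative entropy are $$\mathrm{I}(\mu)=\int_{\mathbb{R}^n}\frac{|\nabla f|^2}{f}\,d\gamma,\qquad \mathrm{H}(\mu)=\int_{\mathbb{R}^n}f\log f\,d\gamma,$$ and the deficit of the logarithmic Sobolev inequality is $\delta(\mu)=\frac12\mathrm{I}(\mu)-\mathrm{H}(\mu)\ge 0$. Centered means the barycenter $\int x\,d\mu$ is $0$. For $p\ge1$, $m_p(\mu)=\int_{\mathbb{R}^n}|x|^p\,d\mu$. The quadratic Wasserstein distance is $W_2(\mu,\nu)=\inf_\pi\left(\iint|x-y|^2\,d\pi(x,y)\right)^{1/2}$, the infimum being over all probability measures $\pi$ on $\mathbb{R}^n\times\mathbb{R}^n$ with marginals $\mu$ and $\nu$. The notation $a_k=O(b_k)$ means that there exist $k_0\in\mathbb{N}$ and $M>0$ with $|a_k|\le M|b_k|$ for all $k\ge k_0$; $a_k=o(b_k)$ means that for every $\varepsilon>0$ there is $k_0\in\mathbb{N}$ with $|a_k|\le\varepsilon|b_k|$ for all $k\ge k_0$. *)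

theory Defs
  imports "HOL-Probability.Probability" "HOL-Library.Landau_Symbols"
begin

definition gauss :: "'a::euclidean_space measure" where
  "gauss = density lborel
     (\<lambda>x. ennreal ((2 * pi) powr (- (real DIM('a) / 2)) * exp (- ((norm x)\<^sup>2 / 2))))"

definition gauss_prob :: "'a::euclidean_space measure \<Rightarrow> bool" where
  "gauss_prob \<mu> \<longleftrightarrow> prob_space \<mu> \<and>
     (\<exists>f. (\<forall>x. 0 \<le> f x) \<and> integrable gauss f \<and> \<mu> = density gauss (\<lambda>x. ennreal (f x)))"

definition centered :: "'a::euclidean_space measure \<Rightarrow> bool" where
  "centered \<mu> \<longleftrightarrow> integrable \<mu> (\<lambda>x. x) \<and> (\<integral>x. x \<partial>\<mu>) = 0"

text \<open>The density \<open>f\<close> in \<open>d\<mu> = f d\<gamma>\<close>; it is determined only up to \<open>\<gamma>\<close>-null sets, and nothing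
  below depends on the representative.\<close>

definition rel_density :: "'a::euclidean_space measure \<Rightarrow> 'a \<Rightarrow> real" where
  "rel_density \<mu> x = enn2real (RN_deriv gauss \<mu> x)"

text \<open>The gradient in the Fisher information is the weak gradient with respect to Lebesgue measure.
  Testing against compactly supported \<open>C\<^sup>1\<close> functions is equivalent to testing against smooth ones.\<close>

definition test_function :: "('a::euclidean_space \<Rightarrow> real) \<Rightarrow> ('a \<Rightarrow> 'a) \<Rightarrow> bool" where
  "test_function \<phi> \<phi>' \<longleftrightarrow> (\<forall>x. GDERIV \<phi> x :> \<phi>' x) \<and> continuous_on UNIV \<phi>' \<and>
     compact (closure {x. \<phi> x \<noteq> 0})"

definition has_weak_gradient :: "('a::euclidean_space \<Rightarrow> real) \<Rightarrow> ('a \<Rightarrow> 'a) \<Rightarrow> bool" where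
  "has_weak_gradient f g \<longleftrightarrow>
     (\<forall>K. compact K \<longrightarrow> set_integrable lborel K f) \<and>
     (\<forall>K. compact K \<longrightarrow> set_integrable lborel K g) \<and>
     (\<forall>\<phi> \<phi>'. test_function \<phi> \<phi>' \<longrightarrow>
        (\<integral>x. f x *\<^sub>R \<phi>' x \<partial>lborel) = - (\<integral>x. \<phi> x *\<^sub>R g x \<partial>lborel))"

definition weak_gradient :: "('a::euclidean_space \<Rightarrow> real) \<Rightarrow> 'a \<Rightarrow> 'a" where
  "weak_gradient f = (SOME g. has_weak_gradient f g)"

text \<open>A weak gradient is unique almost everywhere and vanishes almost everywhere on \<open>{f = 0}\<close>, so
  neither the choice above nor the convention \<open>0 / 0 = 0\<close> affects the integral.\<close>

definition fisher_information :: "'a::euclidean_space measure \<Rightarrow> ennreal" where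
  "fisher_information \<mu> =
     (if \<exists>g. has_weak_gradient (rel_density \<mu>) g
      then \<integral>\<^sup>+x. ennreal ((norm (weak_gradient (rel_density \<mu>) x))\<^sup>2 / rel_density \<mu> x) \<partial>gauss
      else \<infinity>)"

text \<open>A Bochner integral, meaningful only under \<open>finite_entropy\<close>. The library's \<open>ln 0 = 0\<close>
  yields \<open>0 log 0 = 0\<close>.\<close>

definition finite_entropy :: "'a::euclidean_space measure \<Rightarrow> bool" where
  "finite_entropy \<mu> \<longleftrightarrow> integrable gauss (\<lambda>x. rel_density \<mu> x * ln (rel_density \<mu> x))"

definition entropy :: "'a::euclidean_space measure \<Rightarrow> real" where
  "entropy \<mu> = (\<integral>x. rel_density \<mu> x * ln (rel_density \<mu> x) \<partial>gauss)"

text \<open>Meaningful only if \<open>fisher_information \<mu> < \<infinity>\<close> and \<open>finite_entropy \<mu>\<close>.\<close>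

definition deficit :: "'a::euclidean_space measure \<Rightarrow> real" where
  "deficit \<mu> = 1 / 2 * enn2real (fisher_information \<mu>) - entropy \<mu>"

definition moment :: "real \<Rightarrow> 'a::euclidean_space measure \<Rightarrow> ennreal" where
  "moment p \<mu> = (\<integral>\<^sup>+x. ennreal (norm x powr p) \<partial>\<mu>)"

definition couplings ::
  "'a::euclidean_space measure \<Rightarrow> 'a measure \<Rightarrow> ('a \<times> 'a) measure set" where
  "couplings \<mu> \<nu> = {\<pi>. prob_space \<pi> \<and> sets \<pi> = sets (borel \<Otimes>\<^sub>M borel) \<and>
     distr \<pi> borel fst = \<mu> \<and> distr \<pi> borel snd = \<nu>}"

definition ennreal_sqrt :: "ennreal \<Rightarrow> ennreal" where
  "ennreal_sqrt c = (if c = \<infinity> then \<infinity> else ennreal (sqrt (enn2real c)))"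

definition W2 :: "'a::euclidean_space measure \<Rightarrow> 'a measure \<Rightarrow> ennreal" where
  "W2 \<mu> \<nu> = (INF \<pi>\<in>couplings \<mu> \<nu>.
     ennreal_sqrt (\<integral>\<^sup>+z. ennreal ((norm (fst z - snd z))\<^sup>2) \<partial>\<pi>))"

end

theory Submission
  imports Defs "HOL-Real_Asymp.Real_Asymp"
begin

text \<open>The measures are the mixtures of \<open>\<gamma>\<close>, with weight \<open>1 - \<epsilon>\<close>, and of its translates by \<open>v\<close> and \<open>- v\<close>,
  with weight \<open>\<epsilon> / 2\<close> each, where \<open>\<epsilon> = s k\<^sup>-\<^sup>t / 2\<close> and \<open>|v|\<^sup>2 = 4 k\<^sup>2 + m\<^sub>2(\<gamma>) / 2\<close>; the second moment is then
  exact. The three components barely overlap: the overlaps \<open>\<integral> \<surd>(g h) d\<gamma>\<close> of their densities are at most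
  \<open>exp (- |v|\<^sup>2 / 8)\<close>. Up to such terms, the entropy is \<open>\<epsilon> |v|\<^sup>2 / 2\<close> plus the entropy of the mixing weights,
  whose main term is \<open>\<epsilon> ln \<epsilon>\<close>, and the Fisher information is \<open>\<epsilon> |v|\<^sup>2\<close>; so the deficit is \<open>\<epsilon> ln (1 / \<epsilon>)\<close>
  to leading order.

  Undoing the translations costs \<open>\<epsilon> |v|\<^sup>2\<close>, which bounds \<open>W\<^sub>2\<^sup>2\<close> from above. The lower bound is the easy half of
  Kantorovich duality: \<open>|x - y|\<^sup>2 \<ge> (1 - r) |x|\<^sup>2 - |y|\<^sup>2 / r\<close>, where \<open>|y|\<^sup>2\<close> is at most \<open>M\<close> up to an
  exponentially small contribution of the Gaussian tail; \<open>r = \<surd>(ln k) / k\<close> and \<open>M = 4 t ln k\<close> balance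
  the errors.\<close>

section \<open>The Gaussian measure and its translates\<close>

text \<open>The parameters are forced. With weight a k^-t and translation length c k, the transport
  cost requires a c^2 = 2 s, while the mixing weights contribute -a t k^-t log k to the entropy, to
  be matched with -(s t / 2) k^-t log k; hence a = s / 2 and c = 2. The p-th moment then grows with
  the constant a c^p = 2^(p-1) s, which lies between the two constants claimed. Two opposite
  translates keep the barycenter at 0. Translates of \<gamma> are equality cases of the logarithmic
  Sobolev inequality, so the parts of order k^(2-t) cancel in the deficit and only the mixing term
  survives. The obstacle is that \<open>entropy\<close> and \<open>fisher_information\<close> speak
  of a Radon-Nikodym representative and of an arbitrarily chosen weak gradient. The explicit density
  can replace them only after classical gradients are shown to be weak ones and weak gradients to be
  unique almost everywhere.\<close>

lemma nn_integral_exp_norm_square: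
  fixes \<sigma> :: real
  assumes "\<sigma> > 0"
  shows "(\<integral>\<^sup>+(x::'a::euclidean_space). ennreal (exp (- (norm x)\<^sup>2 / (2 * \<sigma>\<^sup>2))) \<partial>lborel)
    = ennreal (sqrt (2 * pi * \<sigma>\<^sup>2) ^ DIM('a))"
proof -
  have sum: "(norm x)\<^sup>2 = (\<Sum>b\<in>Basis. (x \<bullet> b)\<^sup>2)" for x :: 'a
    unfolding power2_norm_eq_inner by (subst euclidean_inner) (simp add: power2_eq_square)
  \<comment> \<open>The one-dimensional integral is read off from the total mass of
    \<open>normal_density\<close>. The free \<sigma> serves twice: 1 normalises
    \<open>gauss\<close>, and sqrt 2 gives its exponential moment.\<close>
  have "(\<integral>\<^sup>+(x::real). ennreal (exp (- x\<^sup>2 / (2 * \<sigma>\<^sup>2))) \<partial>lborel)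
      = (\<integral>\<^sup>+(x::real). ennreal (sqrt (2 * pi * \<sigma>\<^sup>2)) * ennreal (normal_density 0 \<sigma> x) \<partial>lborel)"
    using assms by (intro nn_integral_cong) (simp add: normal_density_def flip: ennreal_mult')
  also have "\<dots> = ennreal (sqrt (2 * pi * \<sigma>\<^sup>2)) * emeasure (density lborel (normal_density 0 \<sigma>)) UNIV"
    by (subst nn_integral_cmult) (simp_all add: emeasure_density)
  also have "\<dots> = ennreal (sqrt (2 * pi * \<sigma>\<^sup>2))"
    using prob_space.emeasure_space_1[OF prob_space_normal_density[OF assms, of 0]] by simp
  finally have 1: "(\<integral>\<^sup>+(x::real). ennreal (exp (- x\<^sup>2 / (2 * \<sigma>\<^sup>2))) \<partial>lborel) = ennreal (sqrt (2 * pi * \<sigma>\<^sup>2))" .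
  have "(\<integral>\<^sup>+(x::'a). ennreal (exp (- (norm x)\<^sup>2 / (2 * \<sigma>\<^sup>2))) \<partial>lborel)
      = (\<integral>\<^sup>+(x::'a). (\<Prod>b\<in>Basis. ennreal (exp (- (x \<bullet> b)\<^sup>2 / (2 * \<sigma>\<^sup>2)))) \<partial>lborel)"
    by (intro nn_integral_cong) (simp add: prod_ennreal sum sum_divide_distrib flip: exp_sum sum_negf)
  also have "\<dots> = (\<Prod>b\<in>(Basis::'a set). (\<integral>\<^sup>+x. ennreal (exp (- x\<^sup>2 / (2 * \<sigma>\<^sup>2))) \<partial>lborel))"
    by (rule nn_integral_lborel_prod) auto
  also have "\<dots> = ennreal (sqrt (2 * pi * \<sigma>\<^sup>2) ^ DIM('a))"
    unfolding 1 by (simp add: ennreal_power)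
  finally show ?thesis .
qed

lemma powr_half_eq_sqrt_power: "(2 * pi) powr (- (real d / 2)) = 1 / sqrt (2 * pi) ^ d"
proof -
  have "(2 * pi) powr (real d / 2) = ((2 * pi) powr (1 / 2)) powr real d"
    by (simp add: powr_powr)
  also have "\<dots> = sqrt (2 * pi) ^ d"
    by (subst powr_half_sqrt) (simp_all add: powr_realpow)
  finally show ?thesis
    by (simp only: powr_minus divide_inverse mult_1)
qed

definition gauss_density :: "'a::euclidean_space \<Rightarrow> real" where
  "gauss_density x = (2 * pi) powr (- (real DIM('a) / 2)) * exp (- ((norm x)\<^sup>2 / 2))"

lemma gauss_density_pos [simp]: "gauss_density x > 0"
  by (simp add: gauss_density_def)

lemma gauss_density_nonneg [simp]: "gauss_density x \<ge> 0"
  by (simp add: less_imp_le)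

lemma borel_measurable_gauss_density [measurable]: "gauss_density \<in> borel_measurable borel"
  unfolding gauss_density_def[abs_def] by measurable

lemma gauss_eq: "gauss = density lborel (\<lambda>x. ennreal (gauss_density x))"
  by (simp add: gauss_def gauss_density_def)

lemma sets_gauss [simp, measurable_cong]: "sets gauss = sets borel"
  by (simp add: gauss_eq)

lemma space_gauss [simp]: "space gauss = UNIV"
  by (simp add: gauss_eq)

lemma nn_integral_gauss:
  "f \<in> borel_measurable borel \<Longrightarrow>
    integral\<^sup>N gauss f = (\<integral>\<^sup>+x. ennreal (gauss_density x) * f x \<partial>lborel)"
  by (simp add: gauss_eq nn_integral_density)

lemma AE_gauss_iff: "(AE x in gauss. P x) \<longleftrightarrow> (AE x in lborel. P x)"
  unfolding gauss_eq by (subst AE_density) simp_all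

lemma prob_space_gauss: "prob_space (gauss :: 'a::euclidean_space measure)"
proof
  have "emeasure (gauss :: 'a measure) UNIV
      = (\<integral>\<^sup>+(x::'a). ennreal (1 / sqrt (2 * pi) ^ DIM('a)) * ennreal (exp (- (norm x)\<^sup>2 / (2 * 1\<^sup>2))) \<partial>lborel)"
    by (simp add: gauss_eq emeasure_density gauss_density_def powr_half_eq_sqrt_power
        flip: ennreal_mult')
  also have "\<dots> = 1"
    by (subst nn_integral_cmult, simp, subst nn_integral_exp_norm_square)
      (simp_all flip: ennreal_mult')
  finally show "emeasure (gauss :: 'a measure) (space gauss) = 1" by simp
qed

interpretation gauss: prob_space gauss
  by (rule prob_space_gauss)

lemma prob_gauss_UNIV: "measure gauss UNIV = 1"
  using gauss.prob_space by simp

text \<open>The rate 1/4 is below the critical 1/2, so the product with the Gaussian density is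
  again a Gaussian profile, of variance 2. This majorant yields all polynomial moments, and its
  integral controls the Gaussian tail in the lower bound for the transport cost.\<close>

lemma integrable_gauss_exp_square:
  "integrable gauss (\<lambda>x::'a::euclidean_space. exp ((norm x)\<^sup>2 / 4))"
proof (rule integrableI_nonneg)
  have "(\<integral>\<^sup>+(x::'a). ennreal (exp ((norm x)\<^sup>2 / 4)) \<partial>gauss)
      = (\<integral>\<^sup>+(x::'a). ennreal (1 / sqrt (2 * pi) ^ DIM('a)) * ennreal (exp (- (norm x)\<^sup>2 / (2 * (sqrt 2)\<^sup>2))) \<partial>lborel)"
    by (subst nn_integral_gauss, simp, intro nn_integral_cong)
      (simp add: gauss_density_def powr_half_eq_sqrt_power flip: ennreal_mult' exp_add)
  also have "\<dots> < \<infinity>"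
    by (subst nn_integral_cmult, simp, subst nn_integral_exp_norm_square)
      (simp_all flip: ennreal_mult')
  finally show "(\<integral>\<^sup>+(x::'a). ennreal (exp ((norm x)\<^sup>2 / 4)) \<partial>gauss) < \<infinity>" .
qed auto

text \<open>Cameron--Martin density of the Gaussian translated by \<open>v\<close>.\<close>

definition shift_density :: "'a::euclidean_space \<Rightarrow> 'a \<Rightarrow> real" where
  "shift_density v x = exp (v \<bullet> x - (norm v)\<^sup>2 / 2)"

lemma shift_density_pos [simp]: "shift_density v x > 0"
  by (simp add: shift_density_def)

lemma shift_density_nonneg [simp]: "shift_density v x \<ge> 0"
  by (simp add: less_imp_le)

lemma continuous_shift_density [continuous_intros]: "continuous_on A (shift_density v)"
  unfolding shift_density_def[abs_def] by (intro continuous_intros)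

lemma borel_measurable_shift_density [measurable]: "shift_density v \<in> borel_measurable borel"
  unfolding shift_density_def[abs_def] by measurable

lemma ln_shift_density: "ln (shift_density v x) = v \<bullet> x - (norm v)\<^sup>2 / 2"
  by (simp add: shift_density_def)

lemma gauss_density_shift: "gauss_density (x + v) * shift_density v (x + v) = gauss_density x"
proof -
  have "(norm (x + v))\<^sup>2 = (norm x)\<^sup>2 + 2 * (v \<bullet> x) + (norm v)\<^sup>2"
    by (simp add: power2_norm_eq_inner inner_simps inner_commute)
  then show ?thesis
    by (simp add: gauss_density_def shift_density_def inner_add_right power2_norm_eq_inner
        flip: exp_add) (simp add: field_simps)
qed

lemma distr_gauss_shift:
  "distr gauss borel (\<lambda>x. x + v) = density gauss (\<lambda>x. ennreal (shift_density v x))"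
proof (rule measure_eqI)
  fix A assume "A \<in> sets (distr gauss borel (\<lambda>x. x + v))"
  then have [measurable]: "A \<in> sets borel" by simp
  have "emeasure (density gauss (\<lambda>x. ennreal (shift_density v x))) A
      = (\<integral>\<^sup>+x. ennreal (gauss_density x) * (ennreal (shift_density v x) * indicator A x) \<partial>lborel)"
    by (simp add: emeasure_density nn_integral_gauss)
  \<comment> \<open>Translation invariance of Lebesgue measure substitutes x + v for x; completing
    the square then absorbs the factor \<open>shift_density\<close>.\<close>
  also have "\<dots> = (\<integral>\<^sup>+x. ennreal (gauss_density x) * (ennreal (shift_density v x) * indicator A x)
      \<partial>distr lborel borel ((+) v))"
    by (simp add: lborel_distr_plus)
  also have "\<dots> = (\<integral>\<^sup>+x. ennreal (gauss_density x) * indicator A (x + v) \<partial>lborel)"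
    by (subst nn_integral_distr)
      (simp_all add: add.commute[of v] gauss_density_shift flip: mult.assoc ennreal_mult')
  also have "\<dots> = (\<integral>\<^sup>+x. indicator A (x + v) \<partial>gauss)"
    by (simp add: nn_integral_gauss)
  also have "\<dots> = (\<integral>\<^sup>+x. indicator A x \<partial>distr gauss borel (\<lambda>x. x + v))"
    by (subst nn_integral_distr) simp_all
  also have "\<dots> = emeasure (distr gauss borel (\<lambda>x. x + v)) A"
    by simp
  finally show "emeasure (distr gauss borel (\<lambda>x. x + v)) A
    = emeasure (density gauss (\<lambda>x. ennreal (shift_density v x))) A" by simp
qed simp

lemma nn_integral_shift_density:
  assumes [measurable]: "F \<in> borel_measurable borel"
  shows "(\<integral>\<^sup>+x. ennreal (shift_density v x) * F x \<partial>gauss) = (\<integral>\<^sup>+x. F (x + v) \<partial>gauss)"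
proof -
  have "(\<integral>\<^sup>+x. ennreal (shift_density v x) * F x \<partial>gauss)
      = (\<integral>\<^sup>+x. F x \<partial>density gauss (\<lambda>x. ennreal (shift_density v x)))"
    by (subst nn_integral_density) simp_all
  also have "\<dots> = (\<integral>\<^sup>+x. F (x + v) \<partial>gauss)"
    by (subst distr_gauss_shift[symmetric], subst nn_integral_distr) simp_all
  finally show ?thesis .
qed

lemma
  fixes F :: "'a::euclidean_space \<Rightarrow> 'b::{banach, second_countable_topology}"
  assumes [measurable]: "F \<in> borel_measurable borel"
  shows integrable_shift_density_iff:
      "integrable gauss (\<lambda>x. shift_density v x *\<^sub>R F x) \<longleftrightarrow> integrable gauss (\<lambda>x. F (x + v))"
    and integral_shift_density:
      "(\<integral>x. shift_density v x *\<^sub>R F x \<partial>gauss) = (\<integral>x. F (x + v) \<partial>gauss)"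
proof -
  have "integrable gauss (\<lambda>x. shift_density v x *\<^sub>R F x)
      \<longleftrightarrow> integrable (density gauss (\<lambda>x. ennreal (shift_density v x))) F"
    by (rule integrable_density[symmetric]) simp_all
  also have "\<dots> \<longleftrightarrow> integrable gauss (\<lambda>x. F (x + v))"
    by (subst distr_gauss_shift[symmetric], rule integrable_distr_eq) simp_all
  finally show "integrable gauss (\<lambda>x. shift_density v x *\<^sub>R F x) \<longleftrightarrow> integrable gauss (\<lambda>x. F (x + v))" .
  have "(\<integral>x. shift_density v x *\<^sub>R F x \<partial>gauss)
      = (\<integral>x. F x \<partial>density gauss (\<lambda>x. ennreal (shift_density v x)))"
    by (rule integral_density[symmetric]) simp_all
  also have "\<dots> = (\<integral>x. F (x + v) \<partial>gauss)"
    by (subst distr_gauss_shift[symmetric], rule integral_distr) simp_all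
  finally show "(\<integral>x. shift_density v x *\<^sub>R F x \<partial>gauss) = (\<integral>x. F (x + v) \<partial>gauss)" .
qed

lemma distr_gauss_uminus: "distr gauss borel uminus = gauss"
proof (rule measure_eqI)
  fix A :: "'a set" assume "A \<in> sets (distr gauss borel uminus)"
  then have [measurable]: "A \<in> sets borel" by simp
  have lb: "distr lborel borel uminus = (lborel :: 'a measure)"
    by (subst lborel_affine[of "-1" 0]) (auto simp: density_1 one_ennreal_def[symmetric])
  have "emeasure gauss A = (\<integral>\<^sup>+x. ennreal (gauss_density x) * indicator A x \<partial>distr lborel borel uminus)"
    by (simp add: gauss_eq emeasure_density lb)
  also have "\<dots> = (\<integral>\<^sup>+x. ennreal (gauss_density x) * indicator A (- x) \<partial>lborel)"
    by (subst nn_integral_distr) (simp_all add: gauss_density_def)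
  also have "\<dots> = (\<integral>\<^sup>+x. indicator A (- x) \<partial>gauss)"
    by (simp add: nn_integral_gauss)
  also have "\<dots> = (\<integral>\<^sup>+x. indicator A x \<partial>distr gauss borel uminus)"
    by (subst nn_integral_distr) simp_all
  finally show "emeasure (distr gauss borel uminus) A = emeasure gauss A" by simp
qed simp

lemma nn_integral_gauss_uminus:
  assumes [measurable]: "F \<in> borel_measurable borel"
  shows "(\<integral>\<^sup>+x. F (- x) \<partial>gauss) = integral\<^sup>N gauss F"
  by (subst (2) distr_gauss_uminus[symmetric], subst nn_integral_distr) simp_all

lemma integral_gauss_uminus:
  fixes F :: "'a::euclidean_space \<Rightarrow> 'b::{banach, second_countable_topology}"
  assumes [measurable]: "F \<in> borel_measurable borel"
  shows "(\<integral>x. F (- x) \<partial>gauss) = integral\<^sup>L gauss F"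
  by (subst (2) distr_gauss_uminus[symmetric], subst integral_distr) simp_all

text \<open>Reflection symmetry makes the integral equal to its negative. The scalar case kills the
  linear terms in second moments and entropies, the vector case gives the barycenter of the
  mixtures.\<close>

lemma integral_gauss_odd:
  fixes F :: "'a::euclidean_space \<Rightarrow> 'b::{banach, second_countable_topology}"
  assumes "F \<in> borel_measurable borel" "\<And>x. F (- x) = - F x"
  shows "integral\<^sup>L gauss F = 0"
proof -
  have "integral\<^sup>L gauss F = - integral\<^sup>L gauss F"
    using integral_gauss_uminus[OF assms(1)] assms(2) by simp
  then have "2 *\<^sub>R integral\<^sup>L gauss F = 0"
    by (metis scaleR_2 add.right_inverse)
  then show ?thesis by simp
qed

section \<open>Moments of the Gaussian and of its translates\<close>

lemma powr_le_exp_square: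
  fixes p C y :: real
  assumes "p \<ge> 0" "y \<ge> 0" "C \<ge> 0"
  shows "(y + C) powr p \<le> exp (4 * p\<^sup>2 + C\<^sup>2 / 8) * exp (y\<^sup>2 / 4)"
proof (cases "y + C = 0")
  case False
  define z where "z = y + C"
  have z: "z > 0" using False assms by (simp add: z_def)
  have "(y + C) powr p \<le> exp (p * z)"
    using z ln_le_minus_one[OF z] assms(1) by (simp add: powr_def mult_left_mono flip: z_def)
  also have "\<dots> \<le> exp (4 * p\<^sup>2 + C\<^sup>2 / 8 + y\<^sup>2 / 4)"
  proof -
    \<comment> \<open>Completing the square trades the linear exponent p z for 4 p^2 + z^2 / 16;
      expanding z = y + C leaves at most y^2 / 8 + C^2 / 8, below the available y^2 / 4.\<close>
    have "0 \<le> (z / 4 - 2 * p)\<^sup>2" by simp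
    then have "p * z \<le> 4 * p\<^sup>2 + z\<^sup>2 / 16" by (simp add: power2_eq_square algebra_simps)
    moreover have "z\<^sup>2 \<le> 2 * y\<^sup>2 + 2 * C\<^sup>2"
      using sum_squares_ge_zero[of "y - C" 0]
      by (simp add: z_def power2_eq_square algebra_simps)
    moreover have "y\<^sup>2 \<ge> 0" by simp
    ultimately show ?thesis unfolding exp_le_cancel_iff by linarith
  qed
  finally show ?thesis by (simp add: exp_add)
qed simp

lemma integrable_gauss_powr:
  assumes "p \<ge> 0" "C \<ge> 0"
  shows "integrable gauss (\<lambda>x::'a::euclidean_space. (norm x + C) powr p)"
proof (rule Bochner_Integration.integrable_bound)
  show "integrable gauss (\<lambda>x. exp (4 * p\<^sup>2 + C\<^sup>2 / 8) * exp ((norm (x::'a))\<^sup>2 / 4))"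
    by (intro integrable_mult_right integrable_gauss_exp_square)
  show "AE x::'a in gauss. norm ((norm x + C) powr p)
      \<le> norm (exp (4 * p\<^sup>2 + C\<^sup>2 / 8) * exp ((norm x)\<^sup>2 / 4))"
    using powr_le_exp_square[OF assms(1) norm_ge_zero assms(2)] by (auto intro!: AE_I2)
qed simp

lemma integrable_gauss_norm_shift_powr:
  assumes "p \<ge> 0"
  shows "integrable gauss (\<lambda>x. norm (x + v) powr p)"
proof (rule Bochner_Integration.integrable_bound[OF integrable_gauss_powr[OF assms norm_ge_zero, of v]])
  show "AE x in gauss. norm (norm (x + v) powr p) \<le> norm ((norm x + norm v) powr p)"
    using assms by (simp add: powr_mono2 norm_triangle_ineq)
qed simp

lemma integrable_gauss_id: "integrable gauss (\<lambda>x. x)"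
proof (rule Bochner_Integration.integrable_bound[OF integrable_gauss_powr[of 1 0]])
qed simp_all

lemma norm_powr_two: "norm x powr 2 = (norm x)\<^sup>2"
  by (cases "x = 0") simp_all

lemma integrable_gauss_norm_square: "integrable gauss (\<lambda>x. (norm x)\<^sup>2)"
proof -
  have "(norm x + 0) powr 2 = (norm x)\<^sup>2" for x :: 'a
    by (cases "x = 0") simp_all
  with integrable_gauss_powr[of 2 0] show ?thesis by simp
qed

lemma has_integral_norm_shift_square:
  fixes v :: "'a::euclidean_space"
  shows "integrable gauss (\<lambda>x. (norm (x + v))\<^sup>2)"
    and "(\<integral>x. (norm (x + v))\<^sup>2 \<partial>gauss) = (\<integral>(x::'a). (norm x)\<^sup>2 \<partial>gauss) + (norm v)\<^sup>2"
proof -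
  have eq: "(norm (x + v))\<^sup>2 = (norm x)\<^sup>2 + 2 * (x \<bullet> v) + (norm v)\<^sup>2" for x
    by (simp add: power2_norm_eq_inner inner_simps inner_commute)
  show "integrable gauss (\<lambda>x. (norm (x + v))\<^sup>2)"
    unfolding eq by (intro Bochner_Integration.integrable_add integrable_gauss_norm_square
        integrable_mult_right integrable_inner_left integrable_gauss_id) simp
  have sq: "integrable gauss (\<lambda>x::'a. (norm x)\<^sup>2)"
    and inn: "integrable gauss (\<lambda>x. 2 * (x \<bullet> v))"
    by (intro integrable_gauss_norm_square integrable_mult_right integrable_inner_left
        integrable_gauss_id)+
  have "(\<integral>x. (norm (x + v))\<^sup>2 \<partial>gauss)
      = (\<integral>(x::'a). (norm x)\<^sup>2 \<partial>gauss) + 2 * (\<integral>x. x \<bullet> v \<partial>gauss) + (norm v)\<^sup>2"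
    unfolding eq Bochner_Integration.integral_add[OF Bochner_Integration.integrable_add[OF sq inn] gauss.integrable_const]
      Bochner_Integration.integral_add[OF sq inn]
    by (simp add: prob_gauss_UNIV)
  then show "(\<integral>x. (norm (x + v))\<^sup>2 \<partial>gauss) = (\<integral>(x::'a). (norm x)\<^sup>2 \<partial>gauss) + (norm v)\<^sup>2"
    by (simp add: integral_gauss_odd)
qed

lemma has_bochner_integral_gauss_const:
  "has_bochner_integral gauss (\<lambda>_. c) c" for c :: real
  by (simp add: has_bochner_integral_iff prob_gauss_UNIV)

lemma has_bochner_integral_shift_density: "has_bochner_integral gauss (shift_density v) 1"
proof -
  have "integrable gauss (shift_density v)" "integral\<^sup>L gauss (shift_density v) = 1"
    using integrable_shift_density_iff[of "\<lambda>_. 1::real" v] integral_shift_density[of "\<lambda>_. 1::real" v]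
    by (simp_all add: prob_gauss_UNIV)
  then show ?thesis by (simp add: has_bochner_integral_iff)
qed

lemma has_bochner_integral_shift_density_inner:
  "has_bochner_integral gauss (\<lambda>x. shift_density v x * (v \<bullet> x)) ((norm v)\<^sup>2)"
proof -
  have 1: "integrable gauss (\<lambda>x. v \<bullet> (x + v))"
    by (intro integrable_inner_right Bochner_Integration.integrable_add integrable_gauss_id) simp
  have "(\<integral>x. v \<bullet> (x + v) \<partial>gauss) = (\<integral>x. v \<bullet> x \<partial>gauss) + (norm v)\<^sup>2"
    using integrable_inner_right[OF integrable_gauss_id, of v]
    by (simp add: inner_add_right prob_gauss_UNIV power2_norm_eq_inner)
  with 1 show ?thesis
    using integrable_shift_density_iff[of "\<lambda>x. v \<bullet> x" v] integral_shift_density[of "\<lambda>x. v \<bullet> x" v]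
    by (simp add: has_bochner_integral_iff integral_gauss_odd)
qed

text \<open>Halving the exponent gives the density of the translate by v / 2, except that |v|^2 / 4
  is subtracted where that density has |v|^2 / 8. The overlap with \<gamma> is therefore an exact
  integral, exp (- |v|^2 / 8).\<close>

lemma sqrt_shift_density:
  "sqrt (shift_density v x) = exp (- (norm v)\<^sup>2 / 8) * shift_density ((1 / 2) *\<^sub>R v) x"
proof -
  have "shift_density v x = (exp (- (norm v)\<^sup>2 / 8) * shift_density ((1 / 2) *\<^sub>R v) x)\<^sup>2"
    by (simp add: shift_density_def power2_eq_square field_simps flip: exp_add)
  then show ?thesis by (simp add: real_sqrt_unique)
qed

lemma has_bochner_integral_sqrt_shift_density:
  "has_bochner_integral gauss (\<lambda>x. sqrt (shift_density v x)) (exp (- (norm v)\<^sup>2 / 8))"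
  using has_bochner_integral_mult_right[where c="exp (- (norm v)\<^sup>2 / 8)",
      OF has_bochner_integral_shift_density[of "(1 / 2) *\<^sub>R v"]]
  unfolding sqrt_shift_density by simp

text \<open>The linear exponents cancel, so the interaction of the two opposite translates is a
  constant function and needs no integration.\<close>

lemma shift_density_mult_uminus: "shift_density v x * shift_density (- v) x = exp (- (norm v)\<^sup>2)"
  by (simp add: shift_density_def flip: exp_add)

section \<open>Weak gradients\<close>

lemma GDERIV_unique: "GDERIV f x :> D \<Longrightarrow> GDERIV f x :> D' \<Longrightarrow> D = D'"
  unfolding gderiv_def using has_derivative_unique by (metis vector_eq_ldot)

lemma GDERIV_imp_continuous_on:
  assumes "\<And>x. GDERIV f x :> f' x"
  shows "continuous_on A f"
  using assms unfolding gderiv_def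
  by (meson continuous_at_imp_continuous_on has_derivative_continuous)

lemma GDERIV_zero_outside:
  assumes F: "GDERIV F x :> F'x" and "closed K" "\<And>x. x \<notin> K \<Longrightarrow> F x = 0" "x \<notin> K"
  shows "F'x = 0"
proof (rule GDERIV_unique[OF F])
  show "GDERIV F x :> 0"
    unfolding gderiv_def
    by (rule has_derivative_transform_within_open[where f="\<lambda>_. 0" and s="- K"])
      (use assms in auto)
qed

lemma integrable_lborel_compact_support:
  fixes f :: "'a::euclidean_space \<Rightarrow> 'b::{banach, second_countable_topology}"
  assumes "continuous_on UNIV f" "compact K" "\<And>x. x \<notin> K \<Longrightarrow> f x = 0"
  shows "integrable lborel f"
proof -
  have "f = (\<lambda>x. indicator K x *\<^sub>R f x)"
    using assms(3) by (auto simp: indicator_def)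
  with borel_integrable_compact[OF assms(2) continuous_on_subset[OF assms(1) subset_UNIV]]
  show ?thesis by simp
qed

lemma
  fixes F :: "'a::euclidean_space \<Rightarrow> 'b::{banach, second_countable_topology}"
  assumes "F \<in> borel_measurable borel"
  shows integrable_lborel_translation: "integrable lborel (\<lambda>x. F (c + x)) \<longleftrightarrow> integrable lborel F"
    and integral_lborel_translation: "(\<integral>x. F (c + x) \<partial>lborel) = integral\<^sup>L lborel F"
  using integrable_distr_eq[of "(+) c" lborel borel F] integral_distr[of "(+) c" lborel borel F] assms
  by (simp_all add: lborel_distr_plus)

text \<open>The difference quotients of \<open>F\<close> have integral zero by translation invariance.\<close>

lemma integral_gradient_compact_support:
  fixes F :: "'a::euclidean_space \<Rightarrow> real"
  assumes F: "\<And>x. GDERIV F x :> F' x" and cont: "continuous_on UNIV F'"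
    and K: "compact K" "\<And>x. x \<notin> K \<Longrightarrow> F x = 0"
  shows "(\<integral>x. F' x \<partial>lborel) = 0"
proof (rule euclidean_eqI)
  fix e :: 'a assume "e \<in> Basis"
  then have e: "norm e = 1" by simp
  have contF: "continuous_on A F" for A
    by (rule GDERIV_imp_continuous_on[OF F])
  have [measurable]: "F \<in> borel_measurable borel"
    by (rule borel_measurable_continuous_onI[OF contF])
  have F'0: "F' x = 0" if "x \<notin> K" for x
    using GDERIV_zero_outside[OF F compact_imp_closed[OF K(1)] K(2) that] by simp
  have intF': "integrable lborel F'" and intF: "integrable lborel F"
    using integrable_lborel_compact_support[OF cont K(1) F'0]
      integrable_lborel_compact_support[OF contF K] by auto
  obtain R where R: "\<And>x. x \<in> K \<Longrightarrow> norm x \<le> R"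
    using compact_imp_bounded[OF K(1)] unfolding bounded_iff by blast
  have "compact (F' ` cball 0 (R + 2))"
    by (rule compact_continuous_image[OF continuous_on_subset[OF cont]]) auto
  from compact_imp_bounded[OF this] obtain B where "\<forall>y\<in>F' ` cball 0 (R + 2). norm y \<le> B"
    unfolding bounded_iff by blast
  then have B: "\<And>x. norm x \<le> R + 2 \<Longrightarrow> norm (F' x) \<le> B" by simp
  define t :: "nat \<Rightarrow> real" where "t n = 1 / (real n + 1)" for n
  have t: "0 < t n" "t n \<le> 1" for n by (simp_all add: t_def field_simps)
  have t_lim: "filterlim t (at 0) sequentially"
    unfolding filterlim_at
  proof
    show "t \<longlonglongrightarrow> 0" unfolding t_def by real_asymp
    show "\<forall>\<^sub>F n in sequentially. t n \<in> UNIV \<and> t n \<noteq> 0" using t(1) by (simp add: less_imp_neq[symmetric])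
  qed
  define q where "q n x = (F (t n *\<^sub>R e + x) - F x) / t n" for n x
  have q_lim: "(\<lambda>n. q n x) \<longlonglongrightarrow> F' x \<bullet> e" for x
  proof -
    have "((\<lambda>r. F (r *\<^sub>R e + x)) has_derivative (\<lambda>r. (r *\<^sub>R e) \<bullet> F' x)) (at 0)"
      by (rule has_derivative_compose[of "\<lambda>r. r *\<^sub>R e + x" _ 0 UNIV F "\<lambda>h. h \<bullet> F' x"])
        (use F[of x] in \<open>auto intro!: derivative_eq_intros simp: gderiv_def\<close>)
    then have "DERIV (\<lambda>r. F (r *\<^sub>R e + x)) 0 :> F' x \<bullet> e"
      by (simp add: has_field_derivative_def inner_commute mult_commute_abs)
    then have "((\<lambda>r. (F (r *\<^sub>R e + x) - F x) / r) \<longlongrightarrow> F' x \<bullet> e) (at 0)"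
      by (simp add: DERIV_def)
    from filterlim_compose[OF this t_lim] show ?thesis by (simp add: q_def)
  qed
  \<comment> \<open>Steps have length at most 1, so all difference quotients vanish outside the ball
    of radius R + 1; inside it, the segment between the two points stays in the convex ball of
    radius R + 2, where the mean value inequality applies.\<close>
  have q_bound: "norm (q n x) \<le> indicator (cball 0 (R + 1)) x * B" for n x
  proof (cases "norm x \<le> R + 1")
    case True
    have "norm (F (t n *\<^sub>R e + x) - F x) \<le> B * norm (t n *\<^sub>R e + x - x)"
    proof (rule differentiable_bound[of "cball 0 (R + 2)" _ "\<lambda>x h. h \<bullet> F' x"])
      show "(F has_derivative (\<lambda>h. h \<bullet> F' y)) (at y within cball 0 (R + 2))" for y
        using F[of y] unfolding gderiv_def by (rule has_derivative_at_withinI)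
      show "onorm (\<lambda>h. h \<bullet> F' y) \<le> B" if "y \<in> cball 0 (R + 2)" for y
      proof (rule onorm_le)
        have "norm (F' y) \<le> B" using that B by simp
        then show "norm (h \<bullet> F' y) \<le> B * norm h" for h
          using Cauchy_Schwarz_ineq2[of h "F' y"] mult_left_mono[of "norm (F' y)" B "norm h"]
          by (simp add: mult.commute)
      qed
      show "t n *\<^sub>R e + x \<in> cball 0 (R + 2)" "x \<in> cball 0 (R + 2)"
        using True norm_triangle_ineq[of "t n *\<^sub>R e" x] t[of n] e by simp_all
    qed simp
    then show ?thesis using True t[of n] e by (simp add: q_def field_simps)
  next
    case False
    have "norm (t n *\<^sub>R e + x) > R"
      using False norm_triangle_ineq2[of x "- (t n *\<^sub>R e)"] t[of n] e by (simp add: add.commute)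
    then have "F (t n *\<^sub>R e + x) = 0" "F x = 0" using R K(2) False by force+
    then show ?thesis using False by (simp add: q_def)
  qed
  have "(\<lambda>n. \<integral>x. q n x \<partial>lborel) \<longlonglongrightarrow> (\<integral>x. F' x \<bullet> e \<partial>lborel)"
  proof (rule integral_dominated_convergence)
    show "integrable lborel (\<lambda>x::'a. indicator (cball 0 (R + 1)) x * B)"
      using borel_integrable_compact[of "cball (0::'a) (R + 1)" "\<lambda>_. B"] by simp
    show "(\<lambda>x. F' x \<bullet> e) \<in> borel_measurable lborel"
      using borel_measurable_continuous_onI[OF cont] by simp
    show "q n \<in> borel_measurable lborel" for n unfolding q_def by simp
  qed (use q_lim q_bound in auto)
  moreover have "(\<integral>x. q n x \<partial>lborel) = 0" for n
    using intF by (simp add: q_def integrable_lborel_translation integral_lborel_translation)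
  ultimately have "(\<integral>x. F' x \<bullet> e \<partial>lborel) = 0"
    by (simp add: LIMSEQ_const_iff)
  then show "(\<integral>x. F' x \<partial>lborel) \<bullet> e = 0 \<bullet> e"
    using intF' by (simp add: integral_inner_left)
qed

text \<open>This is integration by parts: the product of f with a test function is C^1 with compact
  support, so its gradient integrates to zero, and the product rule splits that gradient into the
  two required terms.\<close>

lemma has_weak_gradient_gderiv:
  fixes f :: "'a::euclidean_space \<Rightarrow> real"
  assumes f: "\<And>x. GDERIV f x :> f' x" and cont: "continuous_on UNIV f'"
  shows "has_weak_gradient f f'"
  unfolding has_weak_gradient_def
proof (intro conjI allI impI)
  have contf: "continuous_on A f" for A by (rule GDERIV_imp_continuous_on[OF f])
  show "set_integrable lborel K f" if "compact K" for K
    unfolding set_integrable_def using borel_integrable_compact[OF that contf] by simp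
  show "set_integrable lborel K f'" if "compact K" for K
    unfolding set_integrable_def
    using borel_integrable_compact[OF that continuous_on_subset[OF cont subset_UNIV]] by simp
  fix \<phi> and \<phi>' :: "'a \<Rightarrow> 'a" assume "test_function \<phi> \<phi>'"
  then have \<phi>: "\<And>x. GDERIV \<phi> x :> \<phi>' x" and cont\<phi>': "continuous_on UNIV \<phi>'"
    and K: "compact (closure {x. \<phi> x \<noteq> 0})"
    by (auto simp: test_function_def)
  have cont\<phi>: "continuous_on A \<phi>" for A by (rule GDERIV_imp_continuous_on[OF \<phi>])
  let ?K = "closure {x. \<phi> x \<noteq> 0}"
  have \<phi>0: "\<phi> x = 0" if "x \<notin> ?K" for x
    using that closure_subset[of "{x. \<phi> x \<noteq> 0}"] by auto
  have \<phi>'0: "\<phi>' x = 0" if "x \<notin> ?K" for x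
    using GDERIV_zero_outside[OF \<phi> closed_closure \<phi>0 that] .
  have cont1: "continuous_on UNIV (\<lambda>x. f x *\<^sub>R \<phi>' x)"
    and cont2: "continuous_on UNIV (\<lambda>x. \<phi> x *\<^sub>R f' x)"
    by (intro continuous_intros contf cont\<phi> cont cont\<phi>')+
  have "(\<integral>x. f x *\<^sub>R \<phi>' x + \<phi> x *\<^sub>R f' x \<partial>lborel) = 0"
  proof (rule integral_gradient_compact_support[OF GDERIV_mult[OF f \<phi>] _ K])
    show "f x * \<phi> x = 0" if "x \<notin> ?K" for x using \<phi>0[OF that] by simp
  qed (rule continuous_on_add[OF cont1 cont2])
  moreover have "integrable lborel (\<lambda>x. f x *\<^sub>R \<phi>' x)"
  proof (rule integrable_lborel_compact_support[OF cont1 K])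
    show "f x *\<^sub>R \<phi>' x = 0" if "x \<notin> ?K" for x using \<phi>'0[OF that] by simp
  qed
  moreover have "integrable lborel (\<lambda>x. \<phi> x *\<^sub>R f' x)"
  proof (rule integrable_lborel_compact_support[OF cont2 K])
    show "\<phi> x *\<^sub>R f' x = 0" if "x \<notin> ?K" for x using \<phi>0[OF that] by simp
  qed
  ultimately show "(\<integral>x. f x *\<^sub>R \<phi>' x \<partial>lborel) = - (\<integral>x. \<phi> x *\<^sub>R f' x \<partial>lborel)"
    by (simp add: eq_neg_iff_add_eq_0)
qed

section \<open>Uniqueness of weak gradients\<close>

lemma borel_measurable_locally_integrable:
  fixes H :: "'a::euclidean_space \<Rightarrow> 'b::{banach, second_countable_topology}"
  assumes "\<And>K. compact K \<Longrightarrow> set_integrable lborel K H"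
  shows "H \<in> borel_measurable borel"
proof (rule borel_measurable_LIMSEQ_metric)
  show "(\<lambda>x. indicator (cball 0 (real n)) x *\<^sub>R H x) \<in> borel_measurable borel" for n
    using borel_measurable_integrable[OF assms[of "cball 0 (real n)", unfolded set_integrable_def]]
    by simp
  fix x :: 'a
  obtain N where N: "norm x \<le> real N" using real_arch_simple by blast
  have "\<forall>\<^sub>F n in sequentially. indicator (cball 0 (real n)) x *\<^sub>R H x = H x"
    using eventually_ge_at_top[of N] by eventually_elim (use N in \<open>auto simp: indicator_def\<close>)
  then show "(\<lambda>n. indicator (cball 0 (real n)) x *\<^sub>R H x) \<longlonglongrightarrow> H x"
    by (rule tendsto_eventually)
qed

text \<open>Since \<open>ennreal\<close> truncates at 0, the densities \<open>1 * H x\<close> and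
  \<open>- 1 * H x\<close> are the positive and negative parts of H. The two measures they define
  agree on boxes, an intersection-stable generator of the Borel sets, hence everywhere. So the two
  parts agree almost everywhere, and as one of them is 0 at each point, both vanish.\<close>

lemma AE_zero_if_box_integrals_zero:
  fixes H :: "'a::euclidean_space \<Rightarrow> real"
  assumes int: "\<And>K. compact K \<Longrightarrow> set_integrable lborel K H"
    and zero: "\<And>a b. (\<integral>x. indicator (box a b) x * H x \<partial>lborel) = 0"
  shows "AE x in lborel. H x = 0"
proof -
  have [measurable]: "H \<in> borel_measurable borel"
    by (rule borel_measurable_locally_integrable[OF int])
  have box_int: "integrable lborel (\<lambda>x. indicator (box a b) x * H x)" for a b :: 'a
  proof -
    have "set_integrable lborel (box a b) H"
      by (rule set_integrable_subset[OF int[OF compact_cbox[of a b]]]) (auto simp: box_subset_cbox)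
    then show ?thesis by (simp add: set_integrable_def)
  qed
  have em: "emeasure (density lborel (\<lambda>x. ennreal (c * H x))) (box a b)
      = (\<integral>\<^sup>+x. ennreal (c * (indicator (box a b) x * H x)) \<partial>lborel)" for a b :: 'a and c
    by (subst emeasure_density) (auto intro!: nn_integral_cong simp: indicator_def)
  have fin: "emeasure (density lborel (\<lambda>x. ennreal (c * H x))) (box a b) < \<infinity>"
    if "c = 1 \<or> c = - 1" for a b :: 'a and c
    using box_int[of a b] that unfolding em by (auto simp: real_integrable_def top.not_eq_extremum)
  have eq: "emeasure (density lborel (\<lambda>x. ennreal (1 * H x))) (box a b)
      = emeasure (density lborel (\<lambda>x. ennreal (- 1 * H x))) (box a b)" (is "?P = ?N") for a b :: 'a
  proof -
    have "enn2real ?P = enn2real ?N"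
      using zero[of a b] unfolding real_lebesgue_integral_def[OF box_int] em by simp
    moreover have "?P < \<top>" "?N < \<top>" using fin[of 1 a b] fin[of "- 1" a b] by auto
    ultimately show ?thesis by (metis ennreal_enn2real)
  qed
  let ?E = "range (\<lambda>(a, b). box a b::'a set)"
  have "density lborel (\<lambda>x. ennreal (1 * H x)) = density lborel (\<lambda>x. ennreal (- 1 * H x))"
  proof (rule measure_eqI_generator_eq)
    let ?A = "\<lambda>n::nat. box (- (real n *\<^sub>R One)) (real n *\<^sub>R One) :: 'a set"
    show "Int_stable ?E" by (auto simp: Int_stable_def box_Int_box)
    show "?E \<subseteq> Pow UNIV" "sets (density lborel (\<lambda>x. ennreal (1 * H x))) = sigma_sets UNIV ?E"
      "sets (density lborel (\<lambda>x. ennreal (- 1 * H x))) = sigma_sets UNIV ?E"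
      by (simp_all add: borel_eq_box)
    show "range ?A \<subseteq> ?E" "(\<Union>i. ?A i) = UNIV"
      unfolding UN_box_eq_UNIV by auto
    show "emeasure (density lborel (\<lambda>x. ennreal (1 * H x))) (?A i) \<noteq> \<infinity>" for i
      using fin[of 1] by (auto simp: less_le)
    show "emeasure (density lborel (\<lambda>x. ennreal (1 * H x))) X
        = emeasure (density lborel (\<lambda>x. ennreal (- 1 * H x))) X" if "X \<in> ?E" for X
      using that eq by auto
  qed
  then have "AE x in lborel. ennreal (1 * H x) = ennreal (- 1 * H x)"
    by (subst (asm) sigma_finite_measure.density_unique_iff[OF sigma_finite_lborel]) auto
  then show ?thesis
  proof eventually_elim
    case (elim x)
    then show ?case by (cases "H x \<ge> 0") (auto simp: ennreal_neg ennreal_eq_0_iff)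
  qed
qed

definition continuously_differentiable :: "('a::euclidean_space \<Rightarrow> real) \<Rightarrow> bool" where
  "continuously_differentiable f \<longleftrightarrow>
    (\<exists>f'. (\<forall>x. GDERIV f x :> f' x) \<and> continuous_on UNIV f')"

lemma continuously_differentiable_mult:
  assumes "continuously_differentiable f" "continuously_differentiable g"
  shows "continuously_differentiable (\<lambda>x. f x * g x)"
proof -
  from assms obtain f' g' where f: "\<And>x. GDERIV f x :> f' x" "continuous_on UNIV f'"
    and g: "\<And>x. GDERIV g x :> g' x" "continuous_on UNIV g'"
    unfolding continuously_differentiable_def by auto
  have "continuous_on UNIV (\<lambda>x. f x *\<^sub>R g' x + g x *\<^sub>R f' x)"
    by (intro continuous_intros GDERIV_imp_continuous_on[OF f(1)] GDERIV_imp_continuous_on[OF g(1)]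
        f(2) g(2))
  then show ?thesis
    unfolding continuously_differentiable_def using GDERIV_mult[OF f(1) g(1)]
    by (intro exI[of _ "\<lambda>x. f x *\<^sub>R g' x + g x *\<^sub>R f' x"]) simp
qed

lemma continuously_differentiable_prod:
  "(\<And>i. i \<in> A \<Longrightarrow> continuously_differentiable (f i)) \<Longrightarrow>
    continuously_differentiable (\<lambda>x. \<Prod>i\<in>A. f i x)"
proof (induction A rule: infinite_finite_induct)
  case (insert i A)
  then show ?case by (simp add: continuously_differentiable_mult)
qed (auto simp: continuously_differentiable_def intro!: exI[of _ "\<lambda>_. 0"] GDERIV_const)

text \<open>Squaring removes the kink of the positive part: at 0 the difference quotient is bounded
  by |h|. This gives a C^1 cutoff to a half-line, the building block for cutoffs to boxes.\<close>

lemma DERIV_max_zero_square: "DERIV (\<lambda>u::real. (max 0 u)\<^sup>2) u :> 2 * max 0 u"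
proof (cases u "0::real" rule: linorder_cases)
  case less
  have "DERIV (\<lambda>u::real. (max 0 u)\<^sup>2) u :> 0"
    by (rule has_field_derivative_transform_within_open[where f="\<lambda>_. 0" and S="{..<0}"])
      (use less in auto)
  with less show ?thesis by simp
next
  case equal
  have "((\<lambda>h::real. (max 0 h)\<^sup>2 / h) \<longlongrightarrow> 0) (at 0)"
  proof (rule Lim_null_comparison)
    show "\<forall>\<^sub>F h in at (0::real). norm ((max 0 h)\<^sup>2 / h) \<le> \<bar>h\<bar>"
      by (rule always_eventually) (auto simp: max_def power2_eq_square)
    show "((\<lambda>h::real. \<bar>h\<bar>) \<longlongrightarrow> 0) (at 0)"
      by (rule tendsto_rabs_zero) (rule tendsto_ident_at)
  qed
  then show ?thesis by (simp add: equal DERIV_def)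
next
  case greater
  have "DERIV (\<lambda>u::real. (max 0 u)\<^sup>2) u :> 2 * u"
    by (rule has_field_derivative_transform_within_open[where f="\<lambda>u. u\<^sup>2" and S="{0<..}"])
      (use greater in \<open>auto intro!: derivative_eq_intros\<close>)
  with greater show ?thesis by simp
qed

lemma continuously_differentiable_max_zero_square:
  "continuously_differentiable (\<lambda>x. (max 0 (c + x \<bullet> v))\<^sup>2)"
proof -
  have "GDERIV (\<lambda>x. c + x \<bullet> v) x :> v" for x
    unfolding gderiv_def by (auto intro!: derivative_eq_intros)
  from GDERIV_DERIV_compose[OF this DERIV_max_zero_square]
  have "GDERIV (\<lambda>x. (max 0 (c + x \<bullet> v))\<^sup>2) x :> (2 * max 0 (c + x \<bullet> v)) *\<^sub>R v" for x .
  moreover have "continuous_on UNIV (\<lambda>x. (2 * max 0 (c + x \<bullet> v)) *\<^sub>R v)"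
    by (intro continuous_intros)
  ultimately show ?thesis unfolding continuously_differentiable_def
    by (intro exI[of _ "\<lambda>x. (2 * max 0 (c + x \<bullet> v)) *\<^sub>R v"]) simp
qed

text \<open>The function has one squared positive part for each face of the box, and a factor
  vanishes exactly when the point is on or beyond its face. C^1 regularity is all that
  \<open>test_function\<close> asks for.\<close>

lemma continuously_differentiable_box:
  fixes a b :: "'a::euclidean_space"
  obtains \<psi> where "continuously_differentiable \<psi>" "\<And>x. 0 \<le> \<psi> x" "\<And>x. 0 < \<psi> x \<longleftrightarrow> x \<in> box a b"
proof
  let ?\<psi> = "\<lambda>x. \<Prod>i\<in>Basis. (max 0 (- (a \<bullet> i) + x \<bullet> i))\<^sup>2 * (max 0 (b \<bullet> i + x \<bullet> (- i)))\<^sup>2"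
  show "continuously_differentiable ?\<psi>"
    by (intro continuously_differentiable_prod continuously_differentiable_mult
        continuously_differentiable_max_zero_square)
  show nonneg: "0 \<le> ?\<psi> x" for x by (intro prod_nonneg) auto
  show "0 < ?\<psi> x \<longleftrightarrow> x \<in> box a b" for x
  proof -
    have "0 < ?\<psi> x \<longleftrightarrow> ?\<psi> x \<noteq> 0" using nonneg[of x] by linarith
    also have "\<dots> \<longleftrightarrow> x \<in> box a b" by (auto simp: mem_box max_def)
    finally show ?thesis .
  qed
qed

text \<open>Indicators of boxes are pointwise limits of test functions \<open>m \<psi> / (1 + m \<psi>)\<close>.\<close>

lemma weak_gradient_orthogonal_imp_AE_zero:
  fixes H :: "'a::euclidean_space \<Rightarrow> real"
  assumes int: "\<And>K. compact K \<Longrightarrow> set_integrable lborel K H"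
    and zero: "\<And>\<phi> \<phi>'. test_function \<phi> \<phi>' \<Longrightarrow> (\<integral>x. \<phi> x * H x \<partial>lborel) = 0"
  shows "AE x in lborel. H x = 0"
proof (rule AE_zero_if_box_integrals_zero[OF int])
  fix a b :: 'a
  have [measurable]: "H \<in> borel_measurable borel"
    by (rule borel_measurable_locally_integrable[OF int])
  obtain \<psi> where "continuously_differentiable \<psi>" and nonneg: "\<And>x. 0 \<le> \<psi> x"
    and pos: "\<And>x. 0 < \<psi> x \<longleftrightarrow> x \<in> box a b"
    using continuously_differentiable_box[of a b] by blast
  then obtain \<psi>' where \<psi>: "\<And>x. GDERIV \<psi> x :> \<psi>' x" and cont\<psi>': "continuous_on UNIV \<psi>'"
    unfolding continuously_differentiable_def by blast
  have cont\<psi>: "continuous_on A \<psi>" for A by (rule GDERIV_imp_continuous_on[OF \<psi>])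
  define \<phi> where "\<phi> m x = real m * \<psi> x / (1 + real m * \<psi> x)" for m x
  have den: "1 + real m * \<psi> x > 0" for m x
    using nonneg[of x] by (simp add: add_pos_nonneg)
  have "test_function (\<phi> m) (\<lambda>x. (real m / (1 + real m * \<psi> x)\<^sup>2) *\<^sub>R \<psi>' x)" for m
    unfolding test_function_def
  proof (intro conjI allI)
    fix x
    have "DERIV (\<lambda>y. real m * y / (1 + real m * y)) (\<psi> x) :> real m / (1 + real m * \<psi> x)\<^sup>2"
      using den[of m x]
      by (auto intro!: derivative_eq_intros simp: power2_eq_square field_simps)
    from GDERIV_DERIV_compose[OF \<psi> this]
    show "GDERIV (\<phi> m) x :> (real m / (1 + real m * \<psi> x)\<^sup>2) *\<^sub>R \<psi>' x"
      by (simp add: \<phi>_def[abs_def])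
  next
    show "continuous_on UNIV (\<lambda>x. (real m / (1 + real m * \<psi> x)\<^sup>2) *\<^sub>R \<psi>' x)"
    proof (intro continuous_intros cont\<psi> cont\<psi>' ballI)
      show "(1 + real m * \<psi> x)\<^sup>2 \<noteq> 0" for x using den[of m x] by simp
    qed
    have "{x. \<phi> m x \<noteq> 0} \<subseteq> box a b"
    proof
      fix x assume "x \<in> {x. \<phi> m x \<noteq> 0}"
      then have "\<psi> x \<noteq> 0" by (auto simp: \<phi>_def)
      then show "x \<in> box a b" using pos[of x] nonneg[of x] by simp
    qed
    then show "compact (closure {x. \<phi> m x \<noteq> 0})"
      using bounded_subset[OF bounded_box] by simp
  qed
  then have \<phi>0: "(\<integral>x. \<phi> m x * H x \<partial>lborel) = 0" for m by (rule zero)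
  \<comment> \<open>The majorant lives on the closed box because integrability of H is given on
    compact sets.\<close>
  have \<phi>_bound: "\<bar>\<phi> m x\<bar> \<le> indicator (cbox a b) x" for m x
  proof (cases "x \<in> box a b")
    case True
    then have "x \<in> cbox a b" using box_subset_cbox by blast
    then show ?thesis using nonneg[of x] den[of m x] by (simp add: \<phi>_def field_simps)
  next
    case False
    then have "\<psi> x = 0" using pos[of x] nonneg[of x] by simp
    then show ?thesis by (simp add: \<phi>_def)
  qed
  have \<phi>_lim: "(\<lambda>m. \<phi> m x) \<longlonglongrightarrow> indicator (box a b) x" for x
  proof (cases "x \<in> box a b")
    case True
    then have "0 < \<psi> x" using pos by simp
    then have "(\<lambda>m. \<phi> m x) \<longlonglongrightarrow> 1" unfolding \<phi>_def by real_asymp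
    with True show ?thesis by simp
  next
    case False
    then have "\<psi> x = 0" using pos[of x] nonneg[of x] by simp
    with False show ?thesis by (simp add: \<phi>_def)
  qed
  have "(\<lambda>m. \<integral>x. \<phi> m x * H x \<partial>lborel) \<longlonglongrightarrow> (\<integral>x. indicator (box a b) x * H x \<partial>lborel)"
  proof (rule integral_dominated_convergence)
    show "integrable lborel (\<lambda>x. norm (indicator (cbox a b) x *\<^sub>R H x))"
      using int[OF compact_cbox[of a b]] unfolding set_integrable_def by (rule integrable_norm)
    have [measurable]: "\<psi> \<in> borel_measurable borel"
      by (rule borel_measurable_continuous_onI[OF cont\<psi>])
    show "(\<lambda>x. \<phi> m x * H x) \<in> borel_measurable lborel" for m unfolding \<phi>_def by simp
    show "(\<lambda>x. indicator (box a b) x * H x) \<in> borel_measurable lborel" by simp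
    show "AE x in lborel. (\<lambda>m. \<phi> m x * H x) \<longlonglongrightarrow> indicator (box a b) x * H x"
      by (intro AE_I2 tendsto_mult_right \<phi>_lim)
    show "AE x in lborel. norm (\<phi> m x * H x) \<le> norm (indicator (cbox a b) x *\<^sub>R H x)" for m
      using \<phi>_bound[of m] by (intro AE_I2) (auto simp: abs_mult intro!: mult_right_mono)
  qed
  then show "(\<integral>x. indicator (box a b) x * H x \<partial>lborel) = 0"
    unfolding \<phi>0 by (simp add: LIMSEQ_const_iff)
qed

lemma integrable_test_function_scaleR:
  fixes g :: "'a::euclidean_space \<Rightarrow> 'a"
  assumes "test_function \<phi> \<phi>'" and g: "\<And>K. compact K \<Longrightarrow> set_integrable lborel K g"
  shows "integrable lborel (\<lambda>x. \<phi> x *\<^sub>R g x)"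
proof -
  from assms have \<phi>: "\<And>x. GDERIV \<phi> x :> \<phi>' x" and K: "compact (closure {x. \<phi> x \<noteq> 0})"
    by (auto simp: test_function_def)
  let ?K = "closure {x. \<phi> x \<noteq> 0}"
  have cont: "continuous_on A \<phi>" for A by (rule GDERIV_imp_continuous_on[OF \<phi>])
  have [measurable]: "\<phi> \<in> borel_measurable borel" "g \<in> borel_measurable borel"
    by (rule borel_measurable_continuous_onI[OF cont], rule borel_measurable_locally_integrable[OF g])
  obtain B where B: "\<And>x. x \<in> ?K \<Longrightarrow> norm (\<phi> x) \<le> B"
    using compact_imp_bounded[OF compact_continuous_image[OF cont K]] unfolding bounded_iff by blast
  show ?thesis
  proof (rule Bochner_Integration.integrable_bound)
    show "integrable lborel (\<lambda>x. B *\<^sub>R (indicator ?K x *\<^sub>R g x))"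
      using g[OF K] unfolding set_integrable_def by (rule integrable_scaleR_right)
    have "norm (\<phi> x *\<^sub>R g x) \<le> norm (B *\<^sub>R (indicator ?K x *\<^sub>R g x))" for x
    proof (cases "x \<in> ?K")
      case True
      then show ?thesis using B[OF True] by (auto intro!: mult_right_mono)
    next
      case False
      then have "\<phi> x = 0" using closure_subset[of "{x. \<phi> x \<noteq> 0}"] by auto
      then show ?thesis by simp
    qed
    then show "AE x in lborel. norm (\<phi> x *\<^sub>R g x) \<le> norm (B *\<^sub>R (indicator ?K x *\<^sub>R g x))" by simp
  qed simp
qed

text \<open>Each coordinate of the difference is locally integrable and orthogonal to all test
  functions, hence null; finitely many coordinates keep the exceptional set null. This is what makes
  the choice in \<open>weak_gradient\<close> harmless.\<close>

lemma weak_gradient_unique: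
  fixes f :: "'a::euclidean_space \<Rightarrow> real"
  assumes g: "has_weak_gradient f g" and h: "has_weak_gradient f h"
  shows "AE x in lborel. g x = h x"
proof -
  have gi: "\<And>K. compact K \<Longrightarrow> set_integrable lborel K g"
    and hi: "\<And>K. compact K \<Longrightarrow> set_integrable lborel K h"
    using g h by (auto simp: has_weak_gradient_def)
  have "AE x in lborel. (g x - h x) \<bullet> e = 0" for e
  proof (rule weak_gradient_orthogonal_imp_AE_zero)
    show "set_integrable lborel K (\<lambda>x. (g x - h x) \<bullet> e)" if "compact K" for K
      using integrable_inner_left[OF Bochner_Integration.integrable_diff[OF
            gi[OF that, unfolded set_integrable_def] hi[OF that, unfolded set_integrable_def]], of e]
      by (simp add: set_integrable_def inner_diff_left algebra_simps)
    fix \<phi> and \<phi>' :: "'a \<Rightarrow> 'a" assume t: "test_function \<phi> \<phi>'"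
    note i = integrable_test_function_scaleR[OF t gi] integrable_test_function_scaleR[OF t hi]
    have "(\<integral>x. \<phi> x *\<^sub>R g x \<partial>lborel) = (\<integral>x. \<phi> x *\<^sub>R h x \<partial>lborel)"
    proof -
      have "- (\<integral>x. \<phi> x *\<^sub>R g x \<partial>lborel) = - (\<integral>x. \<phi> x *\<^sub>R h x \<partial>lborel)"
        using g h t unfolding has_weak_gradient_def by auto
      then show ?thesis by (simp only: neg_equal_iff_equal)
    qed
    then have "(\<integral>x. \<phi> x *\<^sub>R g x - \<phi> x *\<^sub>R h x \<partial>lborel) \<bullet> e = 0"
      using i by simp
    then have "(\<integral>x. (\<phi> x *\<^sub>R g x - \<phi> x *\<^sub>R h x) \<bullet> e \<partial>lborel) = 0"
      using i by (simp add: integral_inner_left)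
    then show "(\<integral>x. \<phi> x * ((g x - h x) \<bullet> e) \<partial>lborel) = 0"
      by (simp add: inner_diff_left algebra_simps)
  qed
  then have "AE x in lborel. \<forall>e\<in>Basis. (g x - h x) \<bullet> e = 0"
    by (intro AE_finite_allI) auto
  then show ?thesis
    by eventually_elim (metis euclidean_all_zero_iff eq_iff_diff_eq_0)
qed

section \<open>Entropy, Fisher information and moments of the mixtures\<close>

text \<open>A bound by a square root is what turns \<open>u * ln (1 + r / u)\<close> into a multiple
  of \<open>sqrt (u * r)\<close>, an overlap whose Gaussian integral is known exactly.\<close>

lemma ln_one_plus_le_sqrt:
  fixes y :: real
  assumes "y \<ge> 0"
  shows "ln (1 + y) \<le> 2 * sqrt y"
proof -
  have "1 + y \<le> (1 + sqrt y)\<^sup>2" using assms by (simp add: power2_sum)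
  then have "ln (1 + y) \<le> ln ((1 + sqrt y)\<^sup>2)" using assms by (intro ln_mono) auto
  also have "\<dots> = 2 * ln (1 + sqrt y)" using assms by (simp add: ln_realpow add_pos_nonneg)
  also have "\<dots> \<le> 2 * sqrt y" using ln_add_one_self_le_self[of "sqrt y"] assms by simp
  finally show ?thesis .
qed

lemma mult_ln_add_bounds:
  fixes u r :: real
  assumes "u \<ge> 0" "r \<ge> 0"
  shows "u * ln u \<le> u * ln (u + r)" "u * ln (u + r) \<le> u * ln u + 2 * sqrt (u * r)"
proof -
  show "u * ln u \<le> u * ln (u + r)"
    using assms by (cases "u = 0") (auto intro!: mult_left_mono)
  show "u * ln (u + r) \<le> u * ln u + 2 * sqrt (u * r)"
  proof (cases "u = 0")
    case False
    then have u: "u > 0" using assms by simp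
    have "u + r = u * (1 + r / u)" using u by (simp add: field_simps)
    then have "ln (u + r) = ln (u * (1 + r / u))" by (rule arg_cong)
    also have "\<dots> = ln u + ln (1 + r / u)"
      using u assms by (intro ln_mult_pos) (simp_all add: add_pos_nonneg)
    finally have "u * ln (u + r) = u * ln u + u * ln (1 + r / u)"
      by (simp add: distrib_left)
    also have "\<dots> \<le> u * ln u + u * (2 * sqrt (r / u))"
      using u assms ln_one_plus_le_sqrt[of "r / u"] by simp
    also have "u * (2 * sqrt (r / u)) = 2 * sqrt (u\<^sup>2 * (r / u))"
      using u by (subst real_sqrt_mult) simp
    also have "u\<^sup>2 * (r / u) = u * r" using u by (simp add: power2_eq_square)
    finally show ?thesis by simp
  qed simp
qed

lemma sqrt_mult_add_le:
  fixes a b c :: real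
  assumes "a \<ge> 0" "b \<ge> 0" "c \<ge> 0"
  shows "sqrt (a * (b + c)) \<le> sqrt (a * b) + sqrt (a * c)"
  using sqrt_add_le_add_sqrt[of "a * b" "a * c"] assms by (simp add: distrib_left)

text \<open>Distributing the outer factor leaves three terms of the form
  \<open>a * ln (a + rest)\<close>, each compared with \<open>a * ln a\<close>. The lower bound is
  superadditivity of x ln x. In the upper bound every pair of summands occurs twice, each time with
  the factor 2 of \<open>mult_ln_add_bounds\<close>, which explains the 4.\<close>

lemma sum_mult_ln_bounds:
  fixes a b c :: real
  assumes "a \<ge> 0" "b \<ge> 0" "c \<ge> 0"
  shows "a * ln a + b * ln b + c * ln c \<le> (a + b + c) * ln (a + b + c)"
    and "(a + b + c) * ln (a + b + c)
      \<le> a * ln a + b * ln b + c * ln c + 4 * (sqrt (a * b) + sqrt (a * c) + sqrt (b * c))"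
proof -
  have eq: "(a + b + c) * ln (a + b + c)
      = a * ln (a + (b + c)) + b * ln (b + (a + c)) + c * ln (c + (a + b))"
    by (simp add: algebra_simps)
  show "a * ln a + b * ln b + c * ln c \<le> (a + b + c) * ln (a + b + c)"
    unfolding eq using assms by (intro add_mono mult_ln_add_bounds) auto
  show "(a + b + c) * ln (a + b + c)
      \<le> a * ln a + b * ln b + c * ln c + 4 * (sqrt (a * b) + sqrt (a * c) + sqrt (b * c))"
    using assms mult_ln_add_bounds(2)[of a "b + c"] mult_ln_add_bounds(2)[of b "a + c"]
      mult_ln_add_bounds(2)[of c "a + b"] sqrt_mult_add_le[of a b c] sqrt_mult_add_le[of b a c]
      sqrt_mult_add_le[of c a b]
    unfolding eq by (simp add: mult.commute)
qed

text \<open>Here a is the weight of the central component and p, q are the two translated ones; the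
  fraction is the Fisher integrand divided by |v|^2. Its distance to p + q is exactly (a (p + q) + 4
  p q) / (a + p + q), the interaction of the translates with the center and with each other. Both
  interactions are bounded by quantities with explicit Gaussian integrals.\<close>

lemma fisher_defect_bounds:
  fixes a p q :: real
  assumes a: "1 / 2 \<le> a" "a \<le> 1" and p: "0 \<le> p" and q: "0 \<le> q"
  shows "(p - q)\<^sup>2 / (a + p + q) \<le> p + q"
    and "p + q - (sqrt p + sqrt q + 8 * (p * q)) \<le> (p - q)\<^sup>2 / (a + p + q)"
proof -
  let ?f = "a + p + q"
  have f: "?f > 0" "?f \<ge> 1 / 2" using assms by linarith+
  have eq: "p + q - (p - q)\<^sup>2 / ?f = a * (p + q) / ?f + 4 * (p * q) / ?f"
  proof -
    have "p + q - (p - q)\<^sup>2 / ?f = ((p + q) * ?f - (p - q)\<^sup>2) / ?f"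
      using f by (simp add: diff_divide_distrib)
    also have "(p + q) * ?f - (p - q)\<^sup>2 = a * (p + q) + 4 * (p * q)"
      by (simp add: power2_eq_square algebra_simps)
    finally show ?thesis by (simp only: add_divide_distrib)
  qed
  have nonneg: "0 \<le> a * (p + q) / ?f" "0 \<le> 4 * (p * q) / ?f" using assms f by auto
  with eq show "(p - q)\<^sup>2 / ?f \<le> p + q" by linarith
  have "a * (p + q) \<le> sqrt (p + q) * ?f"
  proof -
    \<comment> \<open>Below 1 the square root is at most 1 and a absorbs it; above 1 it is at most p
      + q, and a <= 1.\<close>
    have "a * sqrt (p + q) \<le> ?f"
    proof (cases "p + q \<le> 1")
      case True
      then have "a * sqrt (p + q) \<le> a * 1" using assms by (intro mult_left_mono) auto
      then show ?thesis using p q by simp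
    next
      case False
      then have "sqrt (p + q) \<le> p + q"
        using self_le_power[of "sqrt (p + q)" 2] by simp
      then show ?thesis using a p q mult_left_le_one_le[of "sqrt (p + q)" a] by simp
    qed
    then have "sqrt (p + q) * (a * sqrt (p + q)) \<le> sqrt (p + q) * ?f"
      by (rule mult_left_mono) (use p q in simp)
    moreover have "sqrt (p + q) * (a * sqrt (p + q)) = a * (p + q)"
      using p q by (simp add: mult.left_commute)
    ultimately show ?thesis by simp
  qed
  then have "a * (p + q) / ?f \<le> sqrt (p + q)" using f by (simp add: pos_divide_le_eq)
  also have "\<dots> \<le> sqrt p + sqrt q" using p q by (rule sqrt_add_le_add_sqrt)
  finally have 1: "a * (p + q) / ?f \<le> sqrt p + sqrt q" .
  have "4 * (p * q) \<le> 8 * (p * q) * ?f"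
    using mult_left_mono[OF f(2), of "8 * (p * q)"] p q by simp
  then have "4 * (p * q) / ?f \<le> 8 * (p * q)" using f by (simp add: pos_divide_le_eq)
  with 1 eq show "p + q - (sqrt p + sqrt q + 8 * (p * q)) \<le> (p - q)\<^sup>2 / ?f" by linarith
qed

section \<open>The symmetric mixture of three Gaussians\<close>

locale gauss_mixture =
  fixes \<epsilon> :: real and v :: "'a::euclidean_space"
  assumes \<epsilon>_nonneg: "0 \<le> \<epsilon>" and \<epsilon>_le: "\<epsilon> \<le> 1 / 2"
begin

definition bump :: "'a \<Rightarrow> 'a \<Rightarrow> real" where
  "bump w x = \<epsilon> / 2 * shift_density w x"

lemma borel_measurable_bump [measurable]: "bump w \<in> borel_measurable borel"
  unfolding bump_def[abs_def] by measurable

definition dens :: "'a \<Rightarrow> real" where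
  "dens x = (1 - \<epsilon>) + bump v x + bump (- v) x"

definition mix :: "'a measure" where
  "mix = density gauss (\<lambda>x. ennreal (dens x))"

lemma bump_nonneg [simp]: "0 \<le> bump w x"
  using \<epsilon>_nonneg by (simp add: bump_def)

lemma dens_ge: "1 / 2 \<le> dens x"
  using bump_nonneg[of v x] bump_nonneg[of "- v" x] \<epsilon>_le unfolding dens_def by linarith

lemma dens_pos [simp]: "0 < dens x"
  using dens_ge[of x] by linarith

lemma dens_nonneg [simp]: "0 \<le> dens x"
  by (simp add: less_imp_le)

lemma borel_measurable_dens [measurable]: "dens \<in> borel_measurable borel"
  unfolding dens_def[abs_def] by measurable

lemma dens_uminus: "dens (- x) = dens x"
  by (simp add: dens_def bump_def shift_density_def)

lemma sets_mix [simp, measurable_cong]: "sets mix = sets borel"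
  by (simp add: mix_def)

lemma nn_integral_mix:
  assumes [measurable]: "F \<in> borel_measurable borel"
  shows "integral\<^sup>N mix F = ennreal (1 - \<epsilon>) * integral\<^sup>N gauss F
    + ennreal (\<epsilon> / 2) * (\<integral>\<^sup>+x. F (x + v) \<partial>gauss) + ennreal (\<epsilon> / 2) * (\<integral>\<^sup>+x. F (x - v) \<partial>gauss)"
proof -
  have "integral\<^sup>N mix F = (\<integral>\<^sup>+x. ennreal (dens x) * F x \<partial>gauss)"
    unfolding mix_def by (subst nn_integral_density) simp_all
  also have "\<dots> = (\<integral>\<^sup>+x. ennreal (1 - \<epsilon>) * F x + ennreal (\<epsilon> / 2) * (ennreal (shift_density v x) * F x)
      + ennreal (\<epsilon> / 2) * (ennreal (shift_density (- v) x) * F x) \<partial>gauss)"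
    using \<epsilon>_nonneg \<epsilon>_le
    by (intro nn_integral_cong)
      (simp add: dens_def bump_def ennreal_mult' distrib_right mult.assoc del: times_divide_eq_left)
  also have "\<dots> = ennreal (1 - \<epsilon>) * integral\<^sup>N gauss F
      + ennreal (\<epsilon> / 2) * (\<integral>\<^sup>+x. ennreal (shift_density v x) * F x \<partial>gauss)
      + ennreal (\<epsilon> / 2) * (\<integral>\<^sup>+x. ennreal (shift_density (- v) x) * F x \<partial>gauss)"
    by (simp add: nn_integral_add nn_integral_cmult)
  finally show ?thesis by (simp add: nn_integral_shift_density)
qed

lemma dens_scaleR:
  fixes F :: "'a \<Rightarrow> 'b::real_vector"
  shows "dens x *\<^sub>R F x = (1 - \<epsilon>) *\<^sub>R F x + (\<epsilon> / 2) *\<^sub>R (shift_density v x *\<^sub>R F x)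
    + (\<epsilon> / 2) *\<^sub>R (shift_density (- v) x *\<^sub>R F x)"
  by (simp add: dens_def bump_def scaleR_add_left)

lemma integrable_dens: "integrable gauss dens"
  unfolding dens_def[abs_def] bump_def
  by (intro Bochner_Integration.integrable_add integrable_mult_right
      integrable.intros[OF has_bochner_integral_shift_density]) simp

lemma prob_space_mix: "prob_space mix"
proof
  have "emeasure mix (space mix) = (\<integral>\<^sup>+x. 1 \<partial>mix)" by simp
  also have "\<dots> = ennreal (1 - \<epsilon>) + ennreal (\<epsilon> / 2) + ennreal (\<epsilon> / 2)"
    by (subst nn_integral_mix) (simp_all add: gauss.emeasure_space_1[simplified])
  also have "\<dots> = 1"
    using \<epsilon>_nonneg \<epsilon>_le by (simp flip: ennreal_plus)
  finally show "emeasure mix (space mix) = 1" .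
qed

lemma gauss_prob_mix: "gauss_prob mix"
  unfolding gauss_prob_def using prob_space_mix integrable_dens mix_def
  by (auto intro!: exI[of _ dens])

lemma centered_mix: "centered mix"
  unfolding centered_def
proof
  have int: "integrable gauss (\<lambda>x. shift_density w x *\<^sub>R x)" for w :: 'a
    by (subst integrable_shift_density_iff)
      (auto intro!: Bochner_Integration.integrable_add integrable_gauss_id)
  have "integrable gauss (\<lambda>x. dens x *\<^sub>R x)"
    unfolding dens_scaleR[of _ "\<lambda>x. x"]
    by (intro Bochner_Integration.integrable_add integrable_scaleR_right integrable_gauss_id int)
  then show "integrable mix (\<lambda>x. x)"
    unfolding mix_def by (subst integrable_density) simp_all
  have "(\<integral>x. x \<partial>mix) = (\<integral>x. dens x *\<^sub>R x \<partial>gauss)"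
    unfolding mix_def by (subst integral_density) simp_all
  also have "\<dots> = 0"
    by (rule integral_gauss_odd) (simp_all add: dens_uminus)
  finally show "(\<integral>x. x \<partial>mix) = 0" .
qed

lemma AE_rel_density_mix: "AE x in gauss. rel_density mix x = dens x"
proof -
  have "AE x in gauss. ennreal (dens x) = RN_deriv gauss mix x"
    by (rule gauss.RN_deriv_unique) (simp_all add: mix_def)
  then show ?thesis
    by eventually_elim (metis dens_nonneg enn2real_ennreal rel_density_def)
qed

lemma borel_measurable_rel_density [measurable]: "rel_density mix \<in> borel_measurable borel"
  unfolding rel_density_def[abs_def] using borel_measurable_RN_deriv[of gauss mix] by measurable

text \<open>This would be the entropy if the three components had disjoint supports: the mean of
  their relative entropies, |v|^2 / 2 for a translate and 0 for the center, minus the Shannon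
  entropy of the weights 1 - \<epsilon>, \<epsilon> / 2, \<epsilon> / 2.\<close>

definition entropy_main :: real where
  "entropy_main = \<epsilon> * (norm v)\<^sup>2 / 2 + \<epsilon> * ln (\<epsilon> / 2) + (1 - \<epsilon>) * ln (1 - \<epsilon>)"

lemma bump_ln_bump:
  "bump w x * ln (bump w x) = (\<epsilon> / 2 * (ln (\<epsilon> / 2) - (norm w)\<^sup>2 / 2)) * shift_density w x
     + \<epsilon> / 2 * (shift_density w x * (w \<bullet> x))"
proof (cases "\<epsilon> = 0")
  case False
  then have eq: "ln (bump w x) = ln (\<epsilon> / 2) + (w \<bullet> x - (norm w)\<^sup>2 / 2)"
    using \<epsilon>_nonneg unfolding bump_def by (subst ln_mult_pos) (simp_all add: ln_shift_density)
  show ?thesis unfolding eq by (simp add: bump_def algebra_simps)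
next
  case True
  then have "bump w x = 0" unfolding bump_def by simp
  then show ?thesis using True by (simp only:)
qed

lemma has_bochner_integral_bump_ln_bump:
  "has_bochner_integral gauss (\<lambda>x. bump w x * ln (bump w x)) (\<epsilon> / 2 * (ln (\<epsilon> / 2) + (norm w)\<^sup>2 / 2))"
proof -
  have "has_bochner_integral gauss (\<lambda>x. bump w x * ln (bump w x))
      ((\<epsilon> / 2 * (ln (\<epsilon> / 2) - (norm w)\<^sup>2 / 2)) * 1 + \<epsilon> / 2 * (norm w)\<^sup>2)"
    unfolding bump_ln_bump
    by (intro has_bochner_integral_add has_bochner_integral_mult_right
        has_bochner_integral_shift_density has_bochner_integral_shift_density_inner)
  then show ?thesis by (simp add: algebra_simps)
qed

lemma has_bochner_integral_sqrt_bump: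
  "has_bochner_integral gauss (\<lambda>x. sqrt (bump w x)) (sqrt (\<epsilon> / 2) * exp (- (norm w)\<^sup>2 / 8))"
  unfolding bump_def real_sqrt_mult
  by (intro has_bochner_integral_mult_right has_bochner_integral_sqrt_shift_density)

lemma bump_mult_bump: "bump v x * bump (- v) x = (\<epsilon> / 2)\<^sup>2 * exp (- (norm v)\<^sup>2)"
  using shift_density_mult_uminus[of v x] by (simp add: bump_def power2_eq_square)

lemma sqrt_half_\<epsilon>_le: "sqrt (\<epsilon> / 2) \<le> 1 / 2"
  using \<epsilon>_nonneg \<epsilon>_le by (intro real_le_lsqrt) (auto simp: power2_eq_square)

lemma exp_norm_bounds: "exp (- (norm v)\<^sup>2 / 2) \<le> exp (- (norm v)\<^sup>2 / 8)"
    "exp (- (norm v)\<^sup>2) \<le> exp (- (norm v)\<^sup>2 / 8)"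
  by simp_all

text \<open>The pointwise sandwich \<open>?L\<close> <= \<open>?h\<close> <= \<open>?L + ?S\<close>
  from \<open>sum_mult_ln_bounds\<close> does everything: its outer terms are integrable with
  explicit integrals, so it gives both the finiteness of the entropy and the two bounds.\<close>

lemma
  shows finite_entropy_mix: "finite_entropy mix"
    and entropy_mix_bounds: "entropy_main \<le> entropy mix"
      "entropy mix \<le> entropy_main + 5 * exp (- (norm v)\<^sup>2 / 8)"
proof -
  let ?L = "\<lambda>x. (1 - \<epsilon>) * ln (1 - \<epsilon>) + bump v x * ln (bump v x) + bump (- v) x * ln (bump (- v) x)"
  let ?S = "\<lambda>x. 4 * (sqrt (bump v x) + sqrt (bump (- v) x) + \<epsilon> / 2 * exp (- (norm v)\<^sup>2 / 2))"
  let ?h = "\<lambda>x. dens x * ln (dens x)"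
  have L: "has_bochner_integral gauss ?L ((1 - \<epsilon>) * ln (1 - \<epsilon>)
      + \<epsilon> / 2 * (ln (\<epsilon> / 2) + (norm v)\<^sup>2 / 2) + \<epsilon> / 2 * (ln (\<epsilon> / 2) + (norm (- v))\<^sup>2 / 2))"
    by (intro has_bochner_integral_add has_bochner_integral_bump_ln_bump has_bochner_integral_gauss_const)
  have S: "has_bochner_integral gauss ?S (4 * (sqrt (\<epsilon> / 2) * exp (- (norm v)\<^sup>2 / 8)
      + sqrt (\<epsilon> / 2) * exp (- (norm (- v))\<^sup>2 / 8) + \<epsilon> / 2 * exp (- (norm v)\<^sup>2 / 2)))"
    by (intro has_bochner_integral_mult_right has_bochner_integral_add has_bochner_integral_sqrt_bump has_bochner_integral_gauss_const)
  have lower: "?L x \<le> ?h x" for x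
    using sum_mult_ln_bounds(1)[of "1 - \<epsilon>" "bump v x" "bump (- v) x"] \<epsilon>_le
    by (simp add: dens_def)
  have upper: "?h x \<le> ?L x + ?S x" for x
  proof -
    have s: "sqrt ((1 - \<epsilon>) * bump w x) \<le> sqrt (bump w x)" for w
      using \<epsilon>_nonneg \<epsilon>_le bump_nonneg[of w x] by (intro real_sqrt_le_mono mult_left_le_one_le) auto
    have m: "sqrt (bump v x * bump (- v) x) = \<epsilon> / 2 * exp (- (norm v)\<^sup>2 / 2)"
    proof -
      have "bump v x * bump (- v) x = (\<epsilon> / 2 * exp (- (norm v)\<^sup>2 / 2))\<^sup>2"
        unfolding bump_mult_bump power_mult_distrib exp_double[symmetric] by simp
      then show ?thesis using \<epsilon>_nonneg by simp
    qed
    have "?h x \<le> ?L x + 4 * (sqrt ((1 - \<epsilon>) * bump v x) + sqrt ((1 - \<epsilon>) * bump (- v) x)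
        + sqrt (bump v x * bump (- v) x))"
      unfolding dens_def using \<epsilon>_le by (intro sum_mult_ln_bounds) auto
    also have "\<dots> \<le> ?L x + ?S x"
      unfolding m by (intro add_left_mono mult_left_mono add_mono s order_refl) simp
    finally show ?thesis .
  qed
  have int: "integrable gauss ?h"
  proof (rule Bochner_Integration.integrable_bound)
    show "integrable gauss (\<lambda>x. \<bar>?L x\<bar> + (\<bar>?L x\<bar> + \<bar>?S x\<bar>))"
      by (intro Bochner_Integration.integrable_add integrable_abs integrable.intros[OF L] integrable.intros[OF S])
    show "AE x in gauss. norm (?h x) \<le> norm (\<bar>?L x\<bar> + (\<bar>?L x\<bar> + \<bar>?S x\<bar>))"
    proof (intro AE_I2)
      fix x
      show "norm (?h x) \<le> norm (\<bar>?L x\<bar> + (\<bar>?L x\<bar> + \<bar>?S x\<bar>))"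
        using lower[of x] upper[of x] unfolding real_norm_def by linarith
    qed
  qed simp
  have AE: "AE x in gauss. rel_density mix x * ln (rel_density mix x) = ?h x"
    using AE_rel_density_mix by eventually_elim simp
  show "finite_entropy mix"
    unfolding finite_entropy_def using int by (subst integrable_cong_AE[OF _ _ AE]) simp_all
  have ent: "entropy mix = integral\<^sup>L gauss ?h"
    unfolding entropy_def by (rule integral_cong_AE[OF _ _ AE]) simp_all
  have "integral\<^sup>L gauss ?L \<le> integral\<^sup>L gauss ?h"
    by (rule integral_mono[OF integrable.intros[OF L] int lower])
  also have "integral\<^sup>L gauss ?L = entropy_main"
    using has_bochner_integral_integral_eq[OF L] by (simp add: entropy_main_def algebra_simps)
  finally show "entropy_main \<le> entropy mix" unfolding ent .
  have "integral\<^sup>L gauss ?h \<le> (\<integral>x. ?L x + ?S x \<partial>gauss)"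
    by (rule integral_mono[OF int Bochner_Integration.integrable_add[OF integrable.intros[OF L]
          integrable.intros[OF S]] upper])
  also have "\<dots> = entropy_main + 4 * (2 * (sqrt (\<epsilon> / 2) * exp (- (norm v)\<^sup>2 / 8))
      + \<epsilon> / 2 * exp (- (norm v)\<^sup>2 / 2))"
    using has_bochner_integral_integral_eq[OF has_bochner_integral_add[OF L S]]
    by (simp add: entropy_main_def algebra_simps)
  \<comment> \<open>The constant 5 is 4 (2 (1/2) + 1/4): the weight is at most 1/2, hence sqrt
    (\<epsilon> / 2) <= 1/2 and \<epsilon> / 2 <= 1/4, and every exponential is at most exp (- |v|^2
    / 8).\<close>
  also have "\<dots> \<le> entropy_main + 4 * (2 * (1 / 2 * exp (- (norm v)\<^sup>2 / 8)) + 1 / 4 * exp (- (norm v)\<^sup>2 / 8))"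
    using sqrt_half_\<epsilon>_le \<epsilon>_nonneg \<epsilon>_le
    by (intro add_left_mono mult_left_mono add_mono mult_mono exp_norm_bounds) auto
  finally show "entropy mix \<le> entropy_main + 5 * exp (- (norm v)\<^sup>2 / 8)"
    unfolding ent by simp
qed

section \<open>Fisher information of the mixture\<close>

definition grad_dens :: "'a \<Rightarrow> 'a" where
  "grad_dens x = (bump v x - bump (- v) x) *\<^sub>R v"

lemma GDERIV_dens: "GDERIV dens x :> grad_dens x"
proof -
  have "GDERIV (shift_density w) x :> shift_density w x *\<^sub>R w" for w
    unfolding gderiv_def shift_density_def[abs_def]
    by (auto intro!: derivative_eq_intros simp: inner_commute mult.commute)
  then have "(shift_density w has_derivative (\<lambda>h. h \<bullet> (shift_density w x *\<^sub>R w))) (at x)" for w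
    by (simp add: gderiv_def)
  note this[derivative_intros]
  show ?thesis
    unfolding gderiv_def dens_def[abs_def] grad_dens_def
    unfolding bump_def
    by (rule derivative_eq_intros refl)+ (auto simp: fun_eq_iff algebra_simps inner_simps)
qed

lemma continuous_grad_dens: "continuous_on UNIV grad_dens"
  unfolding grad_dens_def[abs_def] bump_def by (intro continuous_intros)

text \<open>A weak gradient is tested only through integrals, so it passes from the smooth
  \<open>dens\<close> to \<open>rel_density\<close>, which agrees with it merely almost everywhere.
  Positivity of the Gaussian density makes null sets of \<open>gauss\<close> and of Lebesgue measure
  the same, and uniqueness identifies the chosen weak gradient.\<close>

lemma AE_weak_gradient_rel_density_mix:
  "has_weak_gradient (rel_density mix) grad_dens"
  "AE x in lborel. weak_gradient (rel_density mix) x = grad_dens x"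
proof -
  have AE: "AE x in lborel. dens x = rel_density mix x"
    using AE_rel_density_mix unfolding AE_gauss_iff by eventually_elim simp
  have dens: "has_weak_gradient dens grad_dens"
    by (rule has_weak_gradient_gderiv[OF GDERIV_dens continuous_grad_dens])
  show *: "has_weak_gradient (rel_density mix) grad_dens"
    unfolding has_weak_gradient_def
  proof (intro conjI allI impI)
    fix K :: "'a set" assume K: "compact K"
    have "set_integrable lborel K dens" using dens K by (auto simp: has_weak_gradient_def)
    then show "set_integrable lborel K (rel_density mix)"
      unfolding set_integrable_def
    proof (rule integrable_cong_AE_imp)
      show "(\<lambda>x. indicator K x *\<^sub>R rel_density mix x) \<in> borel_measurable lborel"
        using borel_compact[OF K] by simp
      show "AE x in lborel. indicator K x *\<^sub>R dens x = indicator K x *\<^sub>R rel_density mix x"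
        using AE by eventually_elim simp
    qed
    show "set_integrable lborel K grad_dens" using dens K by (auto simp: has_weak_gradient_def)
  next
    fix \<phi> and \<phi>' :: "'a \<Rightarrow> 'a" assume t: "test_function \<phi> \<phi>'"
    then have [measurable]: "\<phi>' \<in> borel_measurable borel"
      by (auto simp: test_function_def intro: borel_measurable_continuous_onI)
    have "(\<integral>x. rel_density mix x *\<^sub>R \<phi>' x \<partial>lborel) = (\<integral>x. dens x *\<^sub>R \<phi>' x \<partial>lborel)"
    proof (rule integral_cong_AE)
      show "AE x in lborel. rel_density mix x *\<^sub>R \<phi>' x = dens x *\<^sub>R \<phi>' x"
        using AE by eventually_elim simp
    qed simp_all
    also have "\<dots> = - (\<integral>x. \<phi> x *\<^sub>R grad_dens x \<partial>lborel)"
      using dens t by (auto simp: has_weak_gradient_def)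
    finally show "(\<integral>x. rel_density mix x *\<^sub>R \<phi>' x \<partial>lborel) = - (\<integral>x. \<phi> x *\<^sub>R grad_dens x \<partial>lborel)" .
  qed
  have "has_weak_gradient (rel_density mix) (weak_gradient (rel_density mix))"
    unfolding weak_gradient_def by (rule someI[of "has_weak_gradient (rel_density mix)", OF *])
  then show "AE x in lborel. weak_gradient (rel_density mix) x = grad_dens x"
    by (rule weak_gradient_unique) (rule *)
qed

text \<open>The gradient is a scalar multiple of the fixed vector v, so |v|^2 factors out and the
  integrand left is the fraction treated in \<open>fisher_defect_bounds\<close>.\<close>

lemma
  shows fisher_information_mix_finite: "fisher_information mix < \<infinity>"
    and fisher_information_mix_bounds:
      "\<epsilon> * (norm v)\<^sup>2 - 2 * (norm v)\<^sup>2 * exp (- (norm v)\<^sup>2 / 8) \<le> enn2real (fisher_information mix)"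
      "enn2real (fisher_information mix) \<le> \<epsilon> * (norm v)\<^sup>2"
proof -
  let ?J = "\<lambda>x. (bump v x - bump (- v) x)\<^sup>2 / dens x"
  have J0: "0 \<le> ?J x" for x by simp
  have up: "?J x \<le> bump v x + bump (- v) x"
    and low: "bump v x + bump (- v) x
      - (sqrt (bump v x) + sqrt (bump (- v) x) + 8 * ((\<epsilon> / 2)\<^sup>2 * exp (- (norm v)\<^sup>2))) \<le> ?J x" for x
    using fisher_defect_bounds[of "1 - \<epsilon>" "bump v x" "bump (- v) x"] \<epsilon>_nonneg \<epsilon>_le
    unfolding dens_def bump_mult_bump by simp_all
  have bumps: "has_bochner_integral gauss (\<lambda>x. bump v x + bump (- v) x) (\<epsilon> / 2 * 1 + \<epsilon> / 2 * 1)"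
    unfolding bump_def
    by (intro has_bochner_integral_add has_bochner_integral_mult_right has_bochner_integral_shift_density)
  have int: "integrable gauss ?J"
    by (rule Bochner_Integration.integrable_bound[of _ "\<lambda>x. bump v x + bump (- v) x"])
      (use bumps up in \<open>auto simp: has_bochner_integral_iff abs_of_nonneg\<close>)
  have "integral\<^sup>L gauss ?J \<le> (\<integral>x. bump v x + bump (- v) x \<partial>gauss)"
    by (rule integral_mono[OF int integrable.intros[OF bumps] up])
  then have upI: "integral\<^sup>L gauss ?J \<le> \<epsilon>"
    using has_bochner_integral_integral_eq[OF bumps] by simp
  have D: "has_bochner_integral gauss (\<lambda>x. bump v x + bump (- v) x
      - (sqrt (bump v x) + sqrt (bump (- v) x) + 8 * ((\<epsilon> / 2)\<^sup>2 * exp (- (norm v)\<^sup>2))))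
      (\<epsilon> / 2 * 1 + \<epsilon> / 2 * 1 - (sqrt (\<epsilon> / 2) * exp (- (norm v)\<^sup>2 / 8)
      + sqrt (\<epsilon> / 2) * exp (- (norm (- v))\<^sup>2 / 8) + 8 * ((\<epsilon> / 2)\<^sup>2 * exp (- (norm v)\<^sup>2))))"
    by (intro has_bochner_integral_diff bumps has_bochner_integral_add has_bochner_integral_sqrt_bump has_bochner_integral_gauss_const)
  \<comment> \<open>The two overlaps with the center contribute at most 1/2 each and the interaction
    of the translates at most 8/16, in total 3/2 <= 2 times exp (- |v|^2 / 8).\<close>
  have "\<epsilon> - 2 * exp (- (norm v)\<^sup>2 / 8) \<le> \<epsilon> - (2 * (sqrt (\<epsilon> / 2) * exp (- (norm v)\<^sup>2 / 8))
      + 8 * ((\<epsilon> / 2)\<^sup>2 * exp (- (norm v)\<^sup>2)))"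
  proof -
    have "(\<epsilon> / 2)\<^sup>2 \<le> (1 / 4)\<^sup>2" using \<epsilon>_nonneg \<epsilon>_le by (intro power_mono) auto
    then have "(\<epsilon> / 2)\<^sup>2 * exp (- (norm v)\<^sup>2) \<le> 1 / 16 * exp (- (norm v)\<^sup>2 / 8)"
      by (intro mult_mono exp_norm_bounds) (auto simp: power2_eq_square)
    moreover have "sqrt (\<epsilon> / 2) * exp (- (norm v)\<^sup>2 / 8) \<le> 1 / 2 * exp (- (norm v)\<^sup>2 / 8)"
      by (intro mult_right_mono sqrt_half_\<epsilon>_le) simp
    ultimately show ?thesis using exp_ge_zero[of "- (norm v)\<^sup>2 / 8"] by linarith
  qed
  also have "\<dots> \<le> integral\<^sup>L gauss ?J"
  proof -
    have "(\<integral>x. bump v x + bump (- v) x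
      - (sqrt (bump v x) + sqrt (bump (- v) x) + 8 * ((\<epsilon> / 2)\<^sup>2 * exp (- (norm v)\<^sup>2))) \<partial>gauss)
      \<le> integral\<^sup>L gauss ?J"
      by (rule integral_mono[OF integrable.intros[OF D] int low])
    then show ?thesis using has_bochner_integral_integral_eq[OF D] by simp
  qed
  finally have lowI: "\<epsilon> - 2 * exp (- (norm v)\<^sup>2 / 8) \<le> integral\<^sup>L gauss ?J" .
  have "fisher_information mix
      = (\<integral>\<^sup>+x. ennreal ((norm (weak_gradient (rel_density mix) x))\<^sup>2 / rel_density mix x) \<partial>gauss)"
    unfolding fisher_information_def using AE_weak_gradient_rel_density_mix(1) by auto
  also have "\<dots> = (\<integral>\<^sup>+x. ennreal ((norm v)\<^sup>2 * ?J x) \<partial>gauss)"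
  proof (rule nn_integral_cong_AE)
    show "AE x in gauss. ennreal ((norm (weak_gradient (rel_density mix) x))\<^sup>2 / rel_density mix x)
        = ennreal ((norm v)\<^sup>2 * ?J x)"
      using AE_rel_density_mix AE_weak_gradient_rel_density_mix(2)[folded AE_gauss_iff]
      by eventually_elim (simp add: grad_dens_def power_mult_distrib mult.commute)
  qed
  also have "\<dots> = ennreal (\<integral>x. (norm v)\<^sup>2 * ?J x \<partial>gauss)"
    by (rule nn_integral_eq_integral[OF integrable_mult_right[OF int]]) simp
  also have "(\<integral>x. (norm v)\<^sup>2 * ?J x \<partial>gauss) = (norm v)\<^sup>2 * integral\<^sup>L gauss ?J"
    by (rule integral_mult_right_zero)
  finally have I: "fisher_information mix = ennreal ((norm v)\<^sup>2 * integral\<^sup>L gauss ?J)" .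
  then show "fisher_information mix < \<infinity>" by simp
  have "0 \<le> integral\<^sup>L gauss ?J" by (rule Bochner_Integration.integral_nonneg) simp
  then have I': "enn2real (fisher_information mix) = (norm v)\<^sup>2 * integral\<^sup>L gauss ?J"
    unfolding I by simp
  show "enn2real (fisher_information mix) \<le> \<epsilon> * (norm v)\<^sup>2"
    unfolding I' using upI mult_left_mono[OF upI, of "(norm v)\<^sup>2"] by (simp add: mult.commute)
  show "\<epsilon> * (norm v)\<^sup>2 - 2 * (norm v)\<^sup>2 * exp (- (norm v)\<^sup>2 / 8) \<le> enn2real (fisher_information mix)"
    unfolding I' using mult_left_mono[OF lowI, of "(norm v)\<^sup>2"] by (simp add: algebra_simps)
qed

end

section \<open>Moments of the mixture\<close>

lemma moment_gauss:
  "p \<ge> 0 \<Longrightarrow> moment p (gauss :: 'a::euclidean_space measure) = ennreal (\<integral>(x::'a). norm x powr p \<partial>gauss)"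
  unfolding moment_def using integrable_gauss_norm_shift_powr[of p "0::'a"]
  by (intro nn_integral_eq_integral) auto

lemma (in gauss_mixture) moment_mix:
  assumes "p \<ge> 0"
  shows "moment p mix
    = ennreal ((1 - \<epsilon>) * (\<integral>(x::'a). norm x powr p \<partial>gauss) + \<epsilon> * (\<integral>x. norm (x + v) powr p \<partial>gauss))"
proof -
  have eq: "(\<integral>\<^sup>+x. ennreal (norm (x + w) powr p) \<partial>gauss) = ennreal (\<integral>x. norm (x + w) powr p \<partial>gauss)"
    for w :: 'a
    using integrable_gauss_norm_shift_powr[OF assms] by (intro nn_integral_eq_integral) auto
  have sym: "(\<integral>\<^sup>+x. ennreal (norm (x - v) powr p) \<partial>gauss) = (\<integral>\<^sup>+x. ennreal (norm (x + v) powr p) \<partial>gauss)"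
    using nn_integral_gauss_uminus[of "\<lambda>x. ennreal (norm (x + v) powr p)"]
    by (simp add: norm_minus_commute[of v])
  have "moment p mix = ennreal (1 - \<epsilon>) * moment p (gauss :: 'a measure)
      + (ennreal (\<epsilon> / 2) + ennreal (\<epsilon> / 2)) * (\<integral>\<^sup>+x. ennreal (norm (x + v) powr p) \<partial>gauss)"
    unfolding moment_def by (subst nn_integral_mix) (simp_all add: sym distrib_right)
  also have "ennreal (\<epsilon> / 2) + ennreal (\<epsilon> / 2) = ennreal \<epsilon>"
    using \<epsilon>_nonneg by (simp flip: ennreal_plus)
  also have "ennreal (1 - \<epsilon>) * moment p (gauss :: 'a measure)
      + ennreal \<epsilon> * (\<integral>\<^sup>+x. ennreal (norm (x + v) powr p) \<partial>gauss)
      = ennreal ((1 - \<epsilon>) * (\<integral>(x::'a). norm x powr p \<partial>gauss)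
        + \<epsilon> * (\<integral>x. norm (x + v) powr p \<partial>gauss))"
    unfolding moment_gauss[OF assms] eq using \<epsilon>_nonneg \<epsilon>_le
    by (subst ennreal_plus) (simp_all add: ennreal_mult)
  finally show ?thesis .
qed

section \<open>Wasserstein distance of the mixtures to the Gaussian\<close>

text \<open>The right-hand side integrates only the positive part of h. This brings the dual
  potential, which takes negative values, into \<open>ennreal\<close> computations.\<close>

lemma ennreal_integral_le_nn_integral:
  assumes "integrable M h"
  shows "ennreal (integral\<^sup>L M h) \<le> (\<integral>\<^sup>+x. ennreal (h x) \<partial>M)"
proof -
  have "integral\<^sup>L M h \<le> enn2real (\<integral>\<^sup>+x. ennreal (h x) \<partial>M)"
    unfolding real_lebesgue_integral_def[OF assms] by simp
  then have "ennreal (integral\<^sup>L M h) \<le> ennreal (enn2real (\<integral>\<^sup>+x. ennreal (h x) \<partial>M))"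
    by (rule ennreal_leI)
  also have "\<dots> = (\<integral>\<^sup>+x. ennreal (h x) \<partial>M)"
    using assms by (simp add: real_integrable_def less_top)
  finally show ?thesis .
qed

lemma ennreal_sqrt_ennreal: "c \<ge> 0 \<Longrightarrow> ennreal_sqrt (ennreal c) = ennreal (sqrt c)"
  by (simp add: ennreal_sqrt_def)

text \<open>L may be negative, as the transport lower bound is for small k: \<open>sqrt\<close> is
  then negative too, and \<open>ennreal\<close> sends it to 0.\<close>

lemma ennreal_sqrt_mono_real:
  assumes "ennreal L \<le> c"
  shows "ennreal (sqrt L) \<le> ennreal_sqrt c"
proof (cases c)
  case (real c')
  then have "L \<le> c'" using assms by (simp add: ennreal_le_iff)
  then show ?thesis using real by (simp add: ennreal_sqrt_ennreal ennreal_leI)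
qed (simp add: ennreal_sqrt_def)

definition exp_moment :: "'a::euclidean_space itself \<Rightarrow> real" where
  "exp_moment _ = (\<integral>(x::'a). exp ((norm x)\<^sup>2 / 4) \<partial>gauss)"

text \<open>The reverse triangle inequality and Young's inequality with parameter r separate x from
  y. The excess of |y|^2 over M is then bounded through u <= exp u with u = (|y|^2 - M) / 4; this
  replaces a truncation at level M and leaves a function of y with finite Gaussian integral.\<close>

lemma norm_diff_square_lower_bound:
  fixes x y :: "'a::real_inner" and r M :: real
  assumes r: "r > 0"
  shows "(1 - r) * (norm x)\<^sup>2 - M / r
    \<le> (norm (x - y))\<^sup>2 + 4 / r * exp (- M / 4) * exp ((norm y)\<^sup>2 / 4)"
proof -
  define a b where "a = norm x" and "b = norm y"
  have "0 \<le> (sqrt r * a - b / sqrt r)\<^sup>2" by simp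
  also have "\<dots> = r * a\<^sup>2 + b\<^sup>2 / r - 2 * a * b"
    using r by (simp add: power2_diff power_mult_distrib power_divide)
  finally have "2 * a * b \<le> r * a\<^sup>2 + b\<^sup>2 / r" by simp
  moreover have "(a - b)\<^sup>2 \<le> (norm (x - y))\<^sup>2"
    using norm_triangle_ineq3[of x y] unfolding a_def b_def
    by (metis abs_le_square_iff abs_norm_cancel)
  moreover have "(a - b)\<^sup>2 = a\<^sup>2 - 2 * a * b + b\<^sup>2" by (simp add: power2_diff)
  moreover have "b\<^sup>2 \<ge> 0" by simp
  ultimately have "(1 - r) * a\<^sup>2 - b\<^sup>2 / r \<le> (norm (x - y))\<^sup>2"
    unfolding left_diff_distrib by linarith
  moreover have "b\<^sup>2 / r \<le> M / r + 4 / r * exp (- M / 4) * exp (b\<^sup>2 / 4)"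
  proof -
    have "(b\<^sup>2 - M) / 4 \<le> exp ((b\<^sup>2 - M) / 4)"
      using exp_ge_add_one_self[of "(b\<^sup>2 - M) / 4"] by linarith
    then have "b\<^sup>2 \<le> M + 4 * exp ((b\<^sup>2 - M) / 4)" by simp
    then have "b\<^sup>2 / r \<le> (M + 4 * exp ((b\<^sup>2 - M) / 4)) / r"
      using r by (intro divide_right_mono) auto
    also have "\<dots> = M / r + 4 / r * (exp (- M / 4) * exp (b\<^sup>2 / 4))"
      unfolding exp_add[symmetric] by (simp add: add_divide_distrib diff_divide_distrib)
    finally show ?thesis by simp
  qed
  ultimately show ?thesis unfolding a_def b_def by linarith
qed

section \<open>Upper bound for the transport cost by an explicit coupling\<close>

context gauss_mixture
begin

text \<open>This is the law of a random translation: 0 with probability 1 - \<epsilon>, and v or - v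
  with probability \<epsilon> / 2 each. As a \<open>pmf\<close> it carries the discrete
  \<sigma>-algebra, so every kernel on it is measurable.\<close>

definition shift_pmf :: "'a pmf" where
  "shift_pmf = bind_pmf (bernoulli_pmf \<epsilon>) (\<lambda>c. if c
     then map_pmf (\<lambda>s. if s then v else - v) (bernoulli_pmf (1 / 2)) else return_pmf 0)"

text \<open>This is the law of (X + W, X), where X has law \<gamma> and W is independent of X with
  law \<open>shift_pmf\<close>.\<close>

definition shift_coupling :: "('a \<times> 'a) measure" where
  "shift_coupling = measure_pmf shift_pmf \<bind> (\<lambda>w. distr gauss (borel \<Otimes>\<^sub>M borel) (\<lambda>x. (x + w, x)))"

lemma measurable_shift_kernel:
  "(\<lambda>w. distr gauss (borel \<Otimes>\<^sub>M borel) (\<lambda>x::'a. (x + w, x)))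
    \<in> measurable (measure_pmf shift_pmf) (subprob_algebra (borel \<Otimes>\<^sub>M borel))"
  by (auto simp: measurable_pmf_measure1 space_subprob_algebra
      intro!: prob_space_imp_subprob_space gauss.prob_space_distr)

lemma nn_integral_shift_coupling:
  assumes [measurable]: "F \<in> borel_measurable (borel \<Otimes>\<^sub>M borel)"
  shows "integral\<^sup>N shift_coupling F = ennreal (1 - \<epsilon>) * (\<integral>\<^sup>+x. F (x, x) \<partial>gauss)
    + ennreal (\<epsilon> / 2) * (\<integral>\<^sup>+x. F (x + v, x) \<partial>gauss) + ennreal (\<epsilon> / 2) * (\<integral>\<^sup>+x. F (x - v, x) \<partial>gauss)"
proof -
  have "integral\<^sup>N shift_coupling F
      = (\<integral>\<^sup>+w. (\<integral>\<^sup>+z. F z \<partial>distr gauss (borel \<Otimes>\<^sub>M borel) (\<lambda>x::'a. (x + w, x))) \<partial>measure_pmf shift_pmf)"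
    unfolding shift_coupling_def by (rule nn_integral_bind[OF assms measurable_shift_kernel])
  also have "\<dots> = (\<integral>\<^sup>+w. (\<integral>\<^sup>+x. F (x + w, x) \<partial>gauss) \<partial>measure_pmf shift_pmf)"
    by (intro nn_integral_cong, subst nn_integral_distr) simp_all
  also have "\<dots> = ((\<integral>\<^sup>+x. F (x + v, x) \<partial>gauss) * ennreal (1 / 2)
        + (\<integral>\<^sup>+x. F (x - v, x) \<partial>gauss) * ennreal (1 / 2)) * ennreal \<epsilon>
      + (\<integral>\<^sup>+x. F (x, x) \<partial>gauss) * ennreal (1 - \<epsilon>)"
    using \<epsilon>_nonneg \<epsilon>_le by (simp add: shift_pmf_def nn_integral_return_pmf)
  also have "\<dots> = ennreal (1 - \<epsilon>) * (\<integral>\<^sup>+x. F (x, x) \<partial>gauss)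
      + ennreal (1 / 2) * ennreal \<epsilon> * (\<integral>\<^sup>+x. F (x + v, x) \<partial>gauss)
      + ennreal (1 / 2) * ennreal \<epsilon> * (\<integral>\<^sup>+x. F (x - v, x) \<partial>gauss)"
    by (simp add: algebra_simps)
  also have "ennreal (1 / 2) * ennreal \<epsilon> = ennreal (\<epsilon> / 2)"
    using \<epsilon>_nonneg by (subst ennreal_mult[symmetric]) simp_all
  finally show ?thesis .
qed

lemma sets_shift_coupling [simp]: "sets shift_coupling = sets (borel \<Otimes>\<^sub>M borel)"
  unfolding shift_coupling_def by (rule sets_bind) simp_all

lemma shift_coupling_in_couplings: "shift_coupling \<in> couplings mix gauss"
  unfolding couplings_def
proof (intro CollectI conjI)
  show "prob_space shift_coupling"
    unfolding shift_coupling_def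
    by (rule measure_pmf.prob_space_bind[OF _ measurable_shift_kernel])
      (auto intro!: gauss.prob_space_distr)
  show "sets shift_coupling = sets (borel \<Otimes>\<^sub>M borel)" by simp
  have em: "emeasure (distr shift_coupling borel g) A = (\<integral>\<^sup>+z. indicator A (g z) \<partial>shift_coupling)"
    if [measurable]: "g \<in> measurable (borel \<Otimes>\<^sub>M borel) borel" "A \<in> sets borel"
    for g and A :: "'a set"
  proof -
    have [measurable]: "g \<in> measurable shift_coupling borel"
      by (simp cong: measurable_cong_sets)
    have "emeasure (distr shift_coupling borel g) A = (\<integral>\<^sup>+x. indicator A x \<partial>distr shift_coupling borel g)"
      by simp
    also have "\<dots> = (\<integral>\<^sup>+z. indicator A (g z) \<partial>shift_coupling)"
      by (rule nn_integral_distr) simp_all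
    finally show ?thesis .
  qed
  show "distr shift_coupling borel fst = mix"
  proof (rule measure_eqI)
    fix A assume "A \<in> sets (distr shift_coupling borel fst)"
    then have [measurable]: "A \<in> sets borel" by simp
    have "emeasure (distr shift_coupling borel fst) A = (\<integral>\<^sup>+x. indicator A x \<partial>mix)"
      by (simp add: em nn_integral_shift_coupling nn_integral_mix del: nn_integral_indicator)
    then show "emeasure (distr shift_coupling borel fst) A = emeasure mix A" by simp
  qed simp
  show "distr shift_coupling borel snd = gauss"
  proof (rule measure_eqI)
    fix A assume "A \<in> sets (distr shift_coupling borel snd)"
    then have [measurable]: "A \<in> sets borel" by simp
    have "emeasure (distr shift_coupling borel snd) A
        = (ennreal (1 - \<epsilon>) + ennreal (\<epsilon> / 2) + ennreal (\<epsilon> / 2)) * emeasure gauss A"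
      by (simp add: em nn_integral_shift_coupling distrib_right)
    also have "ennreal (1 - \<epsilon>) + ennreal (\<epsilon> / 2) + ennreal (\<epsilon> / 2) = 1"
      using \<epsilon>_nonneg \<epsilon>_le by (simp flip: ennreal_plus)
    finally show "emeasure (distr shift_coupling borel snd) A = emeasure gauss A" by simp
  qed simp
qed

lemma W2_mix_le: "W2 mix gauss \<le> ennreal (sqrt (\<epsilon> * (norm v)\<^sup>2))"
proof -
  have "W2 mix gauss \<le> ennreal_sqrt (\<integral>\<^sup>+z. ennreal ((norm (fst z - snd z))\<^sup>2) \<partial>shift_coupling)"
    unfolding W2_def by (rule INF_lower[OF shift_coupling_in_couplings])
  also have "(\<integral>\<^sup>+z. ennreal ((norm (fst z - snd z))\<^sup>2) \<partial>shift_coupling)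
      = ennreal (\<epsilon> / 2) * ennreal ((norm v)\<^sup>2) + ennreal (\<epsilon> / 2) * ennreal ((norm v)\<^sup>2)"
    by (subst nn_integral_shift_coupling) (simp_all add: gauss.emeasure_space_1[simplified])
  also have "\<dots> = ennreal (\<epsilon> * (norm v)\<^sup>2)"
    using \<epsilon>_nonneg by (simp flip: ennreal_mult ennreal_plus)
  finally show ?thesis using \<epsilon>_nonneg by (simp add: ennreal_sqrt_ennreal)
qed

text \<open>Integrated against \<pi>, the pointwise bound involves only the first marginal on the
  left and only the second in the tail term. The cost is nonnegative, so the positive part of the
  potential may be used on the left. The central component then contributes at least 0, and the
  penalty M / r is paid by the translated mass \<epsilon> alone; without the truncation it would be
  paid by the full mass 1.\<close>

lemma coupling_cost_lower_bound:
  assumes \<pi>: "\<pi> \<in> couplings mix gauss" and r: "0 < r" "r \<le> 1"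
  shows "ennreal (\<epsilon> * ((1 - r) * (norm v)\<^sup>2 - M / r) - 4 / r * exp (- M / 4) * exp_moment TYPE('a))
    \<le> (\<integral>\<^sup>+z. ennreal ((norm (fst z - snd z))\<^sup>2) \<partial>\<pi>)"
proof -
  from \<pi> have sets [measurable_cong]: "sets \<pi> = sets (borel \<Otimes>\<^sub>M borel)"
    and fst: "distr \<pi> borel fst = mix" and snd: "distr \<pi> borel snd = gauss"
    by (auto simp: couplings_def)
  let ?h = "\<lambda>x::'a. (1 - r) * (norm x)\<^sup>2 - M / r"
  let ?c = "\<integral>\<^sup>+z. ennreal ((norm (fst z - snd z))\<^sup>2) \<partial>\<pi>"
  have shift: "ennreal ((1 - r) * (norm v)\<^sup>2 - M / r) \<le> (\<integral>\<^sup>+x. ennreal (?h (x + w)) \<partial>gauss)"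
    if w: "norm w = norm v" for w
  proof -
    have int: "integrable gauss (\<lambda>x. (1 - r) * (norm (x + w))\<^sup>2)"
      by (intro integrable_mult_right has_integral_norm_shift_square)
    have "(\<integral>x. ?h (x + w) \<partial>gauss)
        = (1 - r) * ((\<integral>(x::'a). (norm x)\<^sup>2 \<partial>gauss) + (norm v)\<^sup>2) - M / r"
      by (subst Bochner_Integration.integral_diff[OF int])
        (simp_all add: has_integral_norm_shift_square(2) prob_gauss_UNIV w)
    moreover have "0 \<le> (\<integral>(x::'a). (norm x)\<^sup>2 \<partial>gauss)"
      by (rule Bochner_Integration.integral_nonneg) simp
    ultimately have "(1 - r) * (norm v)\<^sup>2 - M / r \<le> (\<integral>x. ?h (x + w) \<partial>gauss)"
      using r mult_left_mono[of "(norm v)\<^sup>2" "(\<integral>(x::'a). (norm x)\<^sup>2 \<partial>gauss) + (norm v)\<^sup>2" "1 - r"]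
      by simp
    then have "ennreal ((1 - r) * (norm v)\<^sup>2 - M / r) \<le> ennreal (\<integral>x. ?h (x + w) \<partial>gauss)"
      by (rule ennreal_leI)
    also have "\<dots> \<le> (\<integral>\<^sup>+x. ennreal (?h (x + w)) \<partial>gauss)"
      by (rule ennreal_integral_le_nn_integral)
        (rule Bochner_Integration.integrable_diff[OF int gauss.integrable_const])
    finally show ?thesis .
  qed
  let ?H = "(1 - r) * (norm v)\<^sup>2 - M / r"
  have half: "ennreal \<epsilon> = ennreal (\<epsilon> / 2) + ennreal (\<epsilon> / 2)"
    using \<epsilon>_nonneg by (simp flip: ennreal_plus)
  have "ennreal (\<epsilon> * ?H) = (ennreal (\<epsilon> / 2) + ennreal (\<epsilon> / 2)) * ennreal ?H"
    unfolding half[symmetric] using \<epsilon>_nonneg by (rule ennreal_mult')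
  also have "\<dots> \<le> ennreal (1 - \<epsilon>) * (\<integral>\<^sup>+x. ennreal (?h x) \<partial>gauss)
      + ennreal (\<epsilon> / 2) * (\<integral>\<^sup>+x. ennreal (?h (x + v)) \<partial>gauss)
      + ennreal (\<epsilon> / 2) * (\<integral>\<^sup>+x. ennreal (?h (x - v)) \<partial>gauss)"
  proof -
    have "ennreal ?H \<le> (\<integral>\<^sup>+x. ennreal (?h (x - v)) \<partial>gauss)"
      using shift[of "- v"] by simp
    then show ?thesis
      unfolding distrib_right
      by (intro add_mono mult_left_mono add_increasing[OF zero_le]) (use shift[of v] in auto)
  qed
  also have "\<dots> = (\<integral>\<^sup>+x. ennreal (?h x) \<partial>mix)"
    by (rule nn_integral_mix[symmetric]) simp
  also have "\<dots> = (\<integral>\<^sup>+z. ennreal (?h (fst z)) \<partial>\<pi>)"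
    unfolding fst[symmetric] by (rule nn_integral_distr) simp_all
  also have "\<dots> \<le> (\<integral>\<^sup>+z. ennreal ((norm (fst z - snd z))\<^sup>2)
      + ennreal (4 / r * exp (- M / 4)) * ennreal (exp ((norm (snd z))\<^sup>2 / 4)) \<partial>\<pi>)"
  proof (rule nn_integral_mono)
    fix z
    show "ennreal (?h (fst z)) \<le> ennreal ((norm (fst z - snd z))\<^sup>2)
      + ennreal (4 / r * exp (- M / 4)) * ennreal (exp ((norm (snd z))\<^sup>2 / 4))"
      using norm_diff_square_lower_bound[OF r(1), of "fst z" M "snd z"] r
      by (simp add: ennreal_leI flip: ennreal_mult ennreal_plus)
  qed
  also have "\<dots> = ?c + ennreal (4 / r * exp (- M / 4)) * (\<integral>\<^sup>+z. ennreal (exp ((norm (snd z))\<^sup>2 / 4)) \<partial>\<pi>)"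
    by (simp add: nn_integral_add nn_integral_cmult)
  also have "(\<integral>\<^sup>+z. ennreal (exp ((norm (snd z))\<^sup>2 / 4)) \<partial>\<pi>) = (\<integral>\<^sup>+(x::'a). ennreal (exp ((norm x)\<^sup>2 / 4)) \<partial>gauss)"
    unfolding snd[symmetric] by (rule nn_integral_distr[symmetric]) simp_all
  also have "\<dots> = ennreal (exp_moment TYPE('a))"
    unfolding exp_moment_def by (rule nn_integral_eq_integral[OF integrable_gauss_exp_square]) simp
  finally have "ennreal (\<epsilon> * ?H) \<le> ?c + ennreal (4 / r * exp (- M / 4) * exp_moment TYPE('a))"
    using r by (subst ennreal_mult') simp_all
  moreover have "0 \<le> 4 / r * exp (- M / 4) * exp_moment TYPE('a)"
    using r by (simp add: exp_moment_def Bochner_Integration.integral_nonneg)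
  ultimately show ?thesis
    by (subst ennreal_minus[symmetric]) (simp_all add: ennreal_minus_le_iff add.commute)
qed

lemma W2_mix_ge:
  assumes "0 < r" "r \<le> 1"
  shows "ennreal (sqrt (\<epsilon> * ((1 - r) * (norm v)\<^sup>2 - M / r) - 4 / r * exp (- M / 4) * exp_moment TYPE('a)))
    \<le> W2 mix gauss"
  unfolding W2_def
  by (intro INF_greatest ennreal_sqrt_mono_real coupling_cost_lower_bound assms)

lemma W2_mix_finite: "W2 mix gauss < \<infinity>"
  using W2_mix_le by (rule le_less_trans) simp

lemma W2_mix_square_bounds:
  shows "(enn2real (W2 mix gauss))\<^sup>2 \<le> \<epsilon> * (norm v)\<^sup>2"
    and "0 < r \<Longrightarrow> r \<le> 1 \<Longrightarrow>
      \<epsilon> * ((1 - r) * (norm v)\<^sup>2 - M / r) - 4 / r * exp (- M / 4) * exp_moment TYPE('a)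
      \<le> (enn2real (W2 mix gauss))\<^sup>2"
proof -
  obtain w where w: "W2 mix gauss = ennreal w" "w \<ge> 0"
    using W2_mix_finite by (cases "W2 mix gauss") auto
  have "w \<le> sqrt (\<epsilon> * (norm v)\<^sup>2)"
    using W2_mix_le \<epsilon>_nonneg unfolding w(1) by (simp add: ennreal_le_iff)
  then have "w\<^sup>2 \<le> (sqrt (\<epsilon> * (norm v)\<^sup>2))\<^sup>2" using w(2) by (rule power_mono)
  then show "(enn2real (W2 mix gauss))\<^sup>2 \<le> \<epsilon> * (norm v)\<^sup>2"
    using \<epsilon>_nonneg w by simp
  let ?L = "\<epsilon> * ((1 - r) * (norm v)\<^sup>2 - M / r) - 4 / r * exp (- M / 4) * exp_moment TYPE('a)"
  assume "0 < r" "r \<le> 1"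
  from W2_mix_ge[OF this, of M] have "sqrt ?L \<le> w"
    unfolding w(1) using w(2) by (simp add: ennreal_le_iff)
  then have "?L \<le> w\<^sup>2" by (rule sqrt_le_D)
  then show "?L \<le> (enn2real (W2 mix gauss))\<^sup>2" using w by simp
qed

end

section \<open>Asymptotics\<close>

lemma cmult_in_smallo: "f \<in> o[F](g) \<Longrightarrow> (\<lambda>x. c * f x) \<in> o[F](g)"
  for f g :: "'b \<Rightarrow> real"
  by (cases "c = 0") simp_all

lemma cmult_in_bigo: "f \<in> O[F](g) \<Longrightarrow> (\<lambda>x. c * f x) \<in> O[F](g)"
  for f g :: "'b \<Rightarrow> real"
  by (cases "c = 0") simp_all

section \<open>The parameters of the sequence\<close>

locale mixture_sequence =
  fixes s t :: real and e :: "'a::euclidean_space"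
  assumes s: "s > 0" and t: "t > 0" and e: "norm e = 1"
begin

definition m2 :: real where
  "m2 = (\<integral>(x::'a). (norm x)\<^sup>2 \<partial>gauss)"

text \<open>The cap at 1/2 is active for finitely many k only; it makes every member of the sequence
  a mixture in the sense of \<open>gauss_mixture\<close>.\<close>

definition weight :: "nat \<Rightarrow> real" where
  "weight k = min (1 / 2) (s / 2 * real k powr (- t))"

text \<open>The summand \<open>m2 / 2\<close> produces the second-order term of the second moment.\<close>

definition shift_sq :: "nat \<Rightarrow> real" where
  "shift_sq k = 4 * (real k)\<^sup>2 + m2 / 2"

definition shift :: "nat \<Rightarrow> 'a" where
  "shift k = sqrt (shift_sq k) *\<^sub>R e"

abbreviation \<mu> :: "nat \<Rightarrow> 'a measure" where
  "\<mu> k \<equiv> gauss_mixture.mix (weight k) (shift k)"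

lemma m2_nonneg: "0 \<le> m2"
  unfolding m2_def by (rule Bochner_Integration.integral_nonneg) simp

lemma shift_sq_ge: "4 * (real k)\<^sup>2 \<le> shift_sq k"
  using m2_nonneg by (simp add: shift_sq_def)

lemma shift_sq_nonneg: "0 \<le> shift_sq k"
  using m2_nonneg by (simp add: shift_sq_def)

lemma norm_shift: "norm (shift k) = sqrt (shift_sq k)"
  using shift_sq_nonneg by (simp add: shift_def e)

lemma norm_shift_square: "(norm (shift k))\<^sup>2 = shift_sq k"
  using shift_sq_nonneg by (simp add: norm_shift)

lemma gauss_mixture: "gauss_mixture (weight k)"
  by unfold_locales (use s in \<open>auto simp: weight_def\<close>)

lemma eventually_weight:
  "\<forall>\<^sub>F k in sequentially. weight k = s / 2 * real k powr (- t) \<and> s / 2 * real k powr (- t) \<le> 1 / 2"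
proof -
  have "((\<lambda>k. real k powr (- t)) \<longlongrightarrow> 0) sequentially"
    using t by real_asymp
  from tendsto_mult_right_zero[OF this, of "s / 2"]
  have "\<forall>\<^sub>F k in sequentially. s / 2 * real k powr (- t) < 1 / 2"
    by (rule order_tendstoD) simp
  then show ?thesis by eventually_elim (simp add: weight_def)
qed

text \<open>One majorant serves both entropy and deficit. Its parts are the second-order half of
  \<epsilon> |v|^2 / 2, the error of \<open>entropy_main_expansion\<close>, and (|v|^2 + 5) exp (-
  k^2 / 2), where |v|^2 stems from half the Fisher error and 5 from the entropy error.\<close>

definition remainder :: "nat \<Rightarrow> real" where
  "remainder k = (s * m2 / 8 + s / 2 * \<bar>ln (s / 4)\<bar> + s / 2) * real k powr (- t)
    + 4 * ((real k)\<^sup>2 * exp (- (real k)\<^sup>2 / 2)) + (m2 / 2 + 5) * exp (- (real k)\<^sup>2 / 2)"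

lemma remainder_smallo: "remainder \<in> o(\<lambda>k. real k powr (- t) * ln (real k))"
proof -
  have "(\<lambda>k. real k powr (- t)) \<in> o(\<lambda>k. real k powr (- t) * ln (real k))"
    "(\<lambda>k. (real k)\<^sup>2 * exp (- (real k)\<^sup>2 / 2)) \<in> o(\<lambda>k. real k powr (- t) * ln (real k))"
    "(\<lambda>k. exp (- (real k)\<^sup>2 / 2)) \<in> o(\<lambda>k. real k powr (- t) * ln (real k))"
    using t by real_asymp+
  then show ?thesis
    unfolding remainder_def[abs_def]
    by (intro sum_in_smallo cmult_in_smallo)
qed

lemma exp_shift_sq_le: "exp (- shift_sq k / 8) \<le> exp (- (real k)\<^sup>2 / 2)"
  using shift_sq_ge[of k] by simp

lemma weight_shift_sq:
  assumes "k > 0" "\<epsilon> = s / 2 * real k powr (- t)"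
  shows "\<epsilon> * shift_sq k = 2 * s * real k powr (2 - t) + s / 4 * m2 * real k powr (- t)"
proof -
  have "real k powr (2 - t) = real k powr (- t) * (real k)\<^sup>2"
    using assms(1) by (simp add: powr_diff powr_minus divide_inverse mult.commute)
  then show ?thesis by (simp add: assms shift_sq_def algebra_simps)
qed

text \<open>Since \<epsilon> / 2 = (s / 4) k^-t, the term \<epsilon> ln (\<epsilon> / 2) is
  \<epsilon> ln (s / 4) - t \<epsilon> ln k, and t \<epsilon> ln k is exactly the announced main
  term. The weight of the center costs little: (1 - \<epsilon>) ln (1 - \<epsilon>) lies between -
  \<epsilon> and 0.\<close>

lemma entropy_main_expansion:
  assumes "k > 0" and \<epsilon>: "\<epsilon> = s / 2 * real k powr (- t)" "\<epsilon> \<le> 1 / 2"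
  shows "\<bar>\<epsilon> * ln (\<epsilon> / 2) + (1 - \<epsilon>) * ln (1 - \<epsilon>) + s * t / 2 * real k powr (- t) * ln (real k)\<bar>
    \<le> (s / 2 * \<bar>ln (s / 4)\<bar> + s / 2) * real k powr (- t)"
proof -
  have pos: "0 < \<epsilon>" unfolding \<epsilon>(1) using assms(1) s by (intro mult_pos_pos) simp_all
  have "ln (s / 4 * real k powr (- t)) = ln (s / 4) - t * ln (real k)"
    using assms(1) s by (subst ln_mult_pos) (simp_all add: ln_powr)
  moreover have "\<epsilon> / 2 = s / 4 * real k powr (- t)" by (simp add: \<epsilon>(1))
  ultimately have ln: "ln (\<epsilon> / 2) = ln (s / 4) - t * ln (real k)" by (simp only:)
  have 1: "\<epsilon> * ln (\<epsilon> / 2) + s * t / 2 * real k powr (- t) * ln (real k) = \<epsilon> * ln (s / 4)"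
    unfolding ln by (simp add: \<epsilon>(1) algebra_simps)
  have "ln (1 / (1 - \<epsilon>)) \<le> 1 / (1 - \<epsilon>) - 1"
    using \<epsilon> by (intro ln_le_minus_one) simp
  also have "1 / (1 - \<epsilon>) - 1 = \<epsilon> / (1 - \<epsilon>)" using \<epsilon>(2) by (simp add: field_simps)
  finally have "- ln (1 - \<epsilon>) \<le> \<epsilon> / (1 - \<epsilon>)" using \<epsilon>(2) by (simp add: ln_div)
  then have "(1 - \<epsilon>) * (- ln (1 - \<epsilon>)) \<le> (1 - \<epsilon>) * (\<epsilon> / (1 - \<epsilon>))"
    using \<epsilon>(2) by (intro mult_left_mono) auto
  then have 2: "- \<epsilon> \<le> (1 - \<epsilon>) * ln (1 - \<epsilon>)" using \<epsilon>(2) by simp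
  have 3: "(1 - \<epsilon>) * ln (1 - \<epsilon>) \<le> 0"
    using pos \<epsilon>(2) by (intro mult_nonneg_nonpos) auto
  have "\<bar>\<epsilon> * ln (s / 4)\<bar> = \<epsilon> * \<bar>ln (s / 4)\<bar>" using pos by (simp add: abs_mult)
  moreover have "(s / 2 * \<bar>ln (s / 4)\<bar> + s / 2) * real k powr (- t) = \<epsilon> * \<bar>ln (s / 4)\<bar> + \<epsilon>"
    by (simp add: \<epsilon>(1) algebra_simps)
  ultimately show ?thesis using 1 2 3 by linarith
qed

lemma
  shows entropy_asymptotics: "(\<lambda>k. entropy (\<mu> k)
      - (s * real k powr (2 - t) - s * t / 2 * real k powr (- t) * ln (real k)))
      \<in> o(\<lambda>k. real k powr (- t) * ln (real k))" (is ?H)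
    and deficit_asymptotics: "(\<lambda>k. deficit (\<mu> k) - s * t / 2 * real k powr (- t) * ln (real k))
      \<in> o(\<lambda>k. real k powr (- t) * ln (real k))" (is ?D)
proof -
  have ev: "\<forall>\<^sub>F k in sequentially.
      \<bar>entropy (\<mu> k) - (s * real k powr (2 - t) - s * t / 2 * real k powr (- t) * ln (real k))\<bar> \<le> remainder k
      \<and> \<bar>deficit (\<mu> k) - s * t / 2 * real k powr (- t) * ln (real k)\<bar> \<le> remainder k"
    using eventually_weight eventually_gt_at_top[of "0::nat"]
  proof eventually_elim
    case (elim k)
    define \<epsilon> where "\<epsilon> = weight k"
    define D where "D = \<epsilon> * ln (\<epsilon> / 2) + (1 - \<epsilon>) * ln (1 - \<epsilon>) + s * t / 2 * real k powr (- t) * ln (real k)"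
    define A where "A = (s / 2 * \<bar>ln (s / 4)\<bar> + s / 2) * real k powr (- t)"
    define X where "X = exp (- (real k)\<^sup>2 / 2)"
    interpret gauss_mixture "weight k" "shift k" by (rule gauss_mixture)
    have \<epsilon>: "\<epsilon> = s / 2 * real k powr (- t)" "\<epsilon> \<le> 1 / 2" using elim by (auto simp: \<epsilon>_def)
    have D: "\<bar>D\<bar> \<le> A"
      unfolding D_def A_def by (rule entropy_main_expansion) (use elim \<epsilon> in auto)
    have W: "\<epsilon> * shift_sq k = 2 * s * real k powr (2 - t) + s / 4 * m2 * real k powr (- t)"
      by (rule weight_shift_sq) (use elim \<epsilon> in auto)
    have main: "entropy_main = \<epsilon> * shift_sq k / 2 + D - s * t / 2 * real k powr (- t) * ln (real k)"
      by (simp add: entropy_main_def norm_shift_square D_def \<epsilon>_def)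
    have H: "entropy_main \<le> entropy (\<mu> k)" "entropy (\<mu> k) \<le> entropy_main + 5 * X"
      using entropy_mix_bounds exp_shift_sq_le[of k] unfolding norm_shift_square X_def by linarith+
    have "shift_sq k * exp (- shift_sq k / 8) \<le> shift_sq k * X"
      unfolding X_def using exp_shift_sq_le shift_sq_nonneg by (rule mult_left_mono)
    then have I: "\<epsilon> * shift_sq k - 2 * (shift_sq k * X) \<le> enn2real (fisher_information (\<mu> k))"
      "enn2real (fisher_information (\<mu> k)) \<le> \<epsilon> * shift_sq k"
      using fisher_information_mix_bounds unfolding norm_shift_square \<epsilon>_def by linarith+
    have R: "remainder k = s * m2 / 8 * real k powr (- t) + A + shift_sq k * X + 5 * X"
      by (simp add: remainder_def A_def X_def shift_sq_def algebra_simps)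
    have nonneg: "0 \<le> s * m2 / 8 * real k powr (- t)" "0 \<le> shift_sq k * X" "0 \<le> X"
      using s m2_nonneg shift_sq_nonneg[of k] by (simp_all add: X_def)
    show ?case
    proof
      have "\<bar>s * m2 / 8 * real k powr (- t) + D + (entropy (\<mu> k) - entropy_main)\<bar> \<le> remainder k"
        unfolding R abs_le_iff using D H nonneg by (intro conjI) linarith+
      moreover have "entropy (\<mu> k) - (s * real k powr (2 - t) - s * t / 2 * real k powr (- t) * ln (real k))
          = s * m2 / 8 * real k powr (- t) + D + (entropy (\<mu> k) - entropy_main)"
        unfolding main W by (simp add: field_simps)
      ultimately show "\<bar>entropy (\<mu> k) - (s * real k powr (2 - t)
          - s * t / 2 * real k powr (- t) * ln (real k))\<bar> \<le> remainder k" by simp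
      \<comment> \<open>In the deficit the whole of \<epsilon> |v|^2 / 2 cancels, its second-order
        part included; what remains is the mixing term with the opposite sign and exponentially
        small errors.\<close>
      have "\<bar>(1 / 2 * enn2real (fisher_information (\<mu> k)) - \<epsilon> * shift_sq k / 2) - D
          - (entropy (\<mu> k) - entropy_main)\<bar> \<le> remainder k"
        unfolding R abs_le_iff using D H I nonneg by (intro conjI) linarith+
      moreover have "deficit (\<mu> k) - s * t / 2 * real k powr (- t) * ln (real k)
          = (1 / 2 * enn2real (fisher_information (\<mu> k)) - \<epsilon> * shift_sq k / 2) - D
          - (entropy (\<mu> k) - entropy_main)"
        unfolding main deficit_def by simp
      ultimately show "\<bar>deficit (\<mu> k) - s * t / 2 * real k powr (- t) * ln (real k)\<bar> \<le> remainder k"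
        by simp
    qed
  qed
  have "(\<lambda>k. entropy (\<mu> k) - (s * real k powr (2 - t) - s * t / 2 * real k powr (- t) * ln (real k)))
      \<in> O(remainder)"
    using ev by (intro landau_o.bigI[of 1]) (auto elim!: eventually_mono)
  then show ?H by (rule landau_o.big_small_trans[OF _ remainder_smallo])
  have "(\<lambda>k. deficit (\<mu> k) - s * t / 2 * real k powr (- t) * ln (real k)) \<in> O(remainder)"
    using ev by (intro landau_o.bigI[of 1]) (auto elim!: eventually_mono)
  then show ?D by (rule landau_o.big_small_trans[OF _ remainder_smallo])
qed

lemma W2_asymptotics:
  "(\<lambda>k. (enn2real (W2 (\<mu> k) gauss))\<^sup>2 - 2 * s * real k powr (2 - t))
    \<in> O(\<lambda>k. real k powr (1 - t) * sqrt (ln (real k)))"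
proof -
  let ?G = "exp_moment TYPE('a)"
  let ?L = "\<lambda>k. ln (real k)"
  \<comment> \<open>The summands are, in order: the second-order part of \<epsilon> |v|^2, the two
    parts of \<epsilon> r |v|^2, the penalty \<epsilon> M / r, and the Gaussian tail.\<close>
  let ?B = "\<lambda>k. s / 4 * m2 * real k powr (- t)
    + (2 * s * (real k powr (- t) * (sqrt (?L k) * real k))
      + s * m2 / 4 * (real k powr (- t) * (sqrt (?L k) / real k))
      + 2 * s * t * (real k powr (- t) * (?L k * real k / sqrt (?L k)))
      + 4 * ?G * (real k powr (- t) * (real k / sqrt (?L k))))"
  have "\<forall>\<^sub>F k in sequentially. sqrt (?L k) / real k \<le> 1" by real_asymp
  then have "\<forall>\<^sub>F k in sequentially.
      \<bar>(enn2real (W2 (\<mu> k) gauss))\<^sup>2 - 2 * s * real k powr (2 - t)\<bar> \<le> ?B k"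
    using eventually_weight eventually_gt_at_top[of "1::nat"]
  proof eventually_elim
    case (elim k)
    define \<epsilon> where "\<epsilon> = weight k"
    \<comment> \<open>The tail is not multiplied by \<epsilon>, so M is chosen to make exp (- M / 4)
      = k^-t, the size of \<epsilon>. With this M, the errors \<epsilon> r |v|^2 and \<epsilon> M /
      r are both of order k^(1-t) sqrt (ln k) for the given r, and the tail is smaller. Taking k > 1
      ensures r > 0.\<close>
    define r where "r = sqrt (?L k) / real k"
    define M where "M = 4 * t * ?L k"
    interpret gauss_mixture "weight k" "shift k" by (rule gauss_mixture)
    have \<epsilon>: "\<epsilon> = s / 2 * real k powr (- t)" using elim by (auto simp: \<epsilon>_def)
    have L: "?L k > 0" using elim by simp
    have r: "0 < r" "r \<le> 1" using elim L by (auto simp: r_def)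
    have W: "\<epsilon> * shift_sq k = 2 * s * real k powr (2 - t) + s / 4 * m2 * real k powr (- t)"
      by (rule weight_shift_sq) (use elim \<epsilon> in auto)
    have expM: "exp (- M / 4) = real k powr (- t)"
      using elim by (simp add: M_def powr_def)
    have G: "0 \<le> ?G" by (simp add: exp_moment_def Bochner_Integration.integral_nonneg)
    have up: "(enn2real (W2 (\<mu> k) gauss))\<^sup>2 \<le> \<epsilon> * shift_sq k"
      using W2_mix_square_bounds(1) unfolding norm_shift_square \<epsilon>_def .
    have low: "\<epsilon> * ((1 - r) * shift_sq k - M / r) - 4 / r * real k powr (- t) * ?G
        \<le> (enn2real (W2 (\<mu> k) gauss))\<^sup>2"
      using W2_mix_square_bounds(2)[OF r, of M] unfolding norm_shift_square \<epsilon>_def expM .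
    have B: "?B k = s / 4 * m2 * real k powr (- t)
        + (\<epsilon> * (r * shift_sq k + M / r) + 4 / r * real k powr (- t) * ?G)"
    proof -
      have 1: "\<epsilon> * (r * shift_sq k + M / r)
          = s / 2 * real k powr (- t) * (4 * (r * (real k)\<^sup>2) + m2 / 2 * r + M / r)"
        by (simp add: \<epsilon> shift_sq_def algebra_simps)
      have 2: "r * (real k)\<^sup>2 = sqrt (?L k) * real k" "M / r = 4 * t * (?L k * real k / sqrt (?L k))"
        using elim by (simp_all add: r_def M_def power2_eq_square)
      have 3: "4 / r * real k powr (- t) * ?G = 4 * ?G * (real k powr (- t) * (real k / sqrt (?L k)))"
        by (simp add: r_def)
      show ?thesis
        unfolding 1 unfolding 2 3 by (simp add: r_def algebra_simps)
    qed
    have nonneg: "0 \<le> \<epsilon> * (r * shift_sq k + M / r)" "0 \<le> 4 / r * real k powr (- t) * ?G"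
      "0 \<le> s / 4 * m2 * real k powr (- t)"
      using s t r L G m2_nonneg shift_sq_nonneg[of k] by (auto simp: \<epsilon> M_def)
    have "\<epsilon> * ((1 - r) * shift_sq k - M / r) = \<epsilon> * shift_sq k - \<epsilon> * (r * shift_sq k + M / r)"
      by (simp add: algebra_simps)
    with up low nonneg show ?case unfolding B W by linarith
  qed
  then have "(\<lambda>k. (enn2real (W2 (\<mu> k) gauss))\<^sup>2 - 2 * s * real k powr (2 - t)) \<in> O(?B)"
    by (intro landau_o.bigI[of 1]) (auto elim!: eventually_mono)
  moreover have "?B \<in> O(\<lambda>k. real k powr (1 - t) * sqrt (?L k))"
  proof -
    have "(\<lambda>k. real k powr (- t)) \<in> O(\<lambda>k. real k powr (1 - t) * sqrt (?L k))"
      "(\<lambda>k. real k powr (- t) * (sqrt (?L k) * real k)) \<in> O(\<lambda>k. real k powr (1 - t) * sqrt (?L k))"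
      "(\<lambda>k. real k powr (- t) * (sqrt (?L k) / real k)) \<in> O(\<lambda>k. real k powr (1 - t) * sqrt (?L k))"
      "(\<lambda>k. real k powr (- t) * (?L k * real k / sqrt (?L k))) \<in> O(\<lambda>k. real k powr (1 - t) * sqrt (?L k))"
      "(\<lambda>k. real k powr (- t) * (real k / sqrt (?L k))) \<in> O(\<lambda>k. real k powr (1 - t) * sqrt (?L k))"
      by real_asymp+
    then show ?thesis by (intro sum_in_bigo cmult_in_bigo)
  qed
  ultimately show ?thesis by (rule landau_o.big_trans)
qed

section \<open>Asymptotics of the moments\<close>

lemma enn2real_moment_gauss:
  "p \<ge> 0 \<Longrightarrow> enn2real (moment p (gauss :: 'a measure)) = (\<integral>(x::'a). norm x powr p \<partial>gauss)"
  by (simp add: moment_gauss Bochner_Integration.integral_nonneg)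

lemma moment_diff:
  assumes "p \<ge> 0"
  shows "enn2real (moment p (\<mu> k)) - enn2real (moment p (gauss :: 'a measure))
    = weight k * ((\<integral>x. norm (x + shift k) powr p \<partial>gauss) - (\<integral>(x::'a). norm x powr p \<partial>gauss))"
proof -
  interpret gauss_mixture "weight k" "shift k" by (rule gauss_mixture)
  have "0 \<le> (1 - weight k) * (\<integral>(x::'a). norm x powr p \<partial>gauss)
      + weight k * (\<integral>x. norm (x + shift k) powr p \<partial>gauss)"
    using \<epsilon>_nonneg \<epsilon>_le
    by (intro add_nonneg_nonneg mult_nonneg_nonneg Bochner_Integration.integral_nonneg) auto
  then show ?thesis
    using assms by (simp add: moment_mix enn2real_moment_gauss algebra_simps)
qed

lemma second_moment_asymptotics:
  "(\<lambda>k. (enn2real (moment 2 (\<mu> k)) - enn2real (moment 2 (gauss :: 'a measure)))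
      - (2 * s * real k powr (2 - t)
         + s / 4 * enn2real (moment 2 (gauss :: 'a measure)) * real k powr (- t)))
    \<in> o(\<lambda>k. real k powr (- t))"
proof -
  have "\<forall>\<^sub>F k in sequentially. (enn2real (moment 2 (\<mu> k)) - enn2real (moment 2 (gauss :: 'a measure)))
      - (2 * s * real k powr (2 - t)
         + s / 4 * enn2real (moment 2 (gauss :: 'a measure)) * real k powr (- t)) = 0"
    using eventually_weight eventually_gt_at_top[of "0::nat"]
  proof eventually_elim
    case (elim k)
    have g: "enn2real (moment 2 (gauss :: 'a measure)) = m2"
      by (simp add: enn2real_moment_gauss norm_powr_two m2_def)
    have d: "enn2real (moment 2 (\<mu> k)) - enn2real (moment 2 (gauss :: 'a measure))
        = weight k * shift_sq k"
      by (simp add: moment_diff norm_powr_two has_integral_norm_shift_square(2) norm_shift_square)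
    have "weight k * shift_sq k = 2 * s * real k powr (2 - t) + s / 4 * m2 * real k powr (- t)"
      by (rule weight_shift_sq) (use elim in auto)
    then show ?case unfolding d unfolding g by simp
  qed
  then show ?thesis
    by (subst landau_o.small.in_cong[of _ "\<lambda>_. 0"]) simp_all
qed

lemma norm_shift_div_tendsto: "(\<lambda>k. sqrt (shift_sq k) / real k) \<longlonglongrightarrow> 2"
  unfolding shift_sq_def by real_asymp

text \<open>For fixed x the quotient |x + v_k| / k tends to 2, because x shifts the norm by at most
  |x|. The domination by |x| + C comes from |v_k| <= C k for k >= 1, with C^2 = 4 + m2 / 2.\<close>

lemma scaled_moment_tendsto:
  assumes p: "p \<ge> 0"
  shows "(\<lambda>k. (\<integral>x. norm (x + shift k) powr p \<partial>gauss) / real k powr p) \<longlonglongrightarrow> 2 powr p"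
proof -
  define C where "C = sqrt (4 + m2 / 2)"
  have "(\<lambda>k. \<integral>x. (norm (x + shift k) / real k) powr p \<partial>gauss) \<longlonglongrightarrow> (\<integral>(x::'a). 2 powr p \<partial>gauss)"
  proof (rule integral_dominated_convergence)
    show "integrable gauss (\<lambda>x::'a. (norm x + C) powr p)"
      by (rule integrable_gauss_powr[OF p]) (use m2_nonneg in \<open>simp add: C_def\<close>)
    have bound: "norm (x + shift k) / real k \<le> norm x + C" for x k
    \<comment> \<open>At k = 0 the quotient is 0 by the convention for division, so the majorant
      holds for every k, as dominated convergence requires.\<close>
    proof (cases "k = 0")
      case False
      have "shift_sq k \<le> (4 + m2 / 2) * (real k)\<^sup>2"
        using False m2_nonneg by (simp add: shift_sq_def distrib_right mult_le_cancel_left1)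
      then have "sqrt (shift_sq k) \<le> C * real k"
        unfolding C_def by (metis real_sqrt_le_mono real_sqrt_mult real_sqrt_abs abs_of_nat)
      then have "norm (x + shift k) \<le> norm x * real k + C * real k"
        using norm_triangle_ineq[of x "shift k"] False mult_left_mono[of 1 "real k" "norm x"]
        by (simp add: norm_shift)
      then show ?thesis using False by (simp add: field_simps)
    qed (use m2_nonneg in \<open>simp add: C_def\<close>)
    show "AE x in gauss. norm ((norm (x + shift k) / real k) powr p) \<le> (norm x + C) powr p" for k
      using bound p by (intro AE_I2) (auto intro!: powr_mono2)
    show "AE x in gauss. (\<lambda>k. (norm (x + shift k) / real k) powr p) \<longlonglongrightarrow> 2 powr p"
    proof (intro AE_I2)
      fix x :: 'a
      have "(\<lambda>k. norm (x + shift k) / real k) \<longlonglongrightarrow> 2"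
      proof (rule Lim_transform[OF norm_shift_div_tendsto])
        show "(\<lambda>k. norm (x + shift k) / real k - sqrt (shift_sq k) / real k) \<longlonglongrightarrow> 0"
        proof (rule Lim_null_comparison)
          show "\<forall>\<^sub>F k in sequentially.
              norm (norm (x + shift k) / real k - sqrt (shift_sq k) / real k) \<le> norm x / real k"
            using eventually_gt_at_top[of "0::nat"]
          proof eventually_elim
            case (elim k)
            have "\<bar>norm (x + shift k) - norm (shift k)\<bar> \<le> norm x"
              using norm_triangle_ineq3[of "x + shift k" "shift k"] by simp
            then show ?case using elim
              by (simp add: norm_shift divide_right_mono flip: diff_divide_distrib)
          qed
          show "(\<lambda>k. norm x / real k) \<longlonglongrightarrow> 0" by (rule lim_const_over_n)
        qed
      qed
      then show "(\<lambda>k. (norm (x + shift k) / real k) powr p) \<longlonglongrightarrow> 2 powr p"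
        by (rule tendsto_powr) auto
    qed
  qed simp_all
  then show ?thesis
    by (simp add: powr_divide prob_gauss_UNIV)
qed

text \<open>The weight turns the limit 2^p of the scaled moments into (s / 2) 2^p = 2^(p-1) s, while
  the fixed Gaussian moment is negligible against k^p. This determines the leading constant, of
  which the theorem asserts only bounds.\<close>

lemma moment_asymptotics:
  assumes p: "p \<ge> 1"
  shows "(\<lambda>k. enn2real (moment p (\<mu> k)) - enn2real (moment p (gauss :: 'a measure))
      - 2 powr (p - 1) * s * real k powr (p - t)) \<in> o(\<lambda>k. real k powr (p - t))"
proof -
  define mp where "mp = (\<integral>(x::'a). norm x powr p \<partial>gauss)"
  define Mp where "Mp k = (\<integral>x. norm (x + shift k) powr p \<partial>gauss)" for k
  have "(\<lambda>k. mp / real k powr p) \<longlonglongrightarrow> 0"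
    using p by real_asymp
  then have "(\<lambda>k. s / 2 * (Mp k / real k powr p - mp / real k powr p - 2 powr p))
      \<longlonglongrightarrow> s / 2 * (2 powr p - 0 - 2 powr p)"
    using scaled_moment_tendsto[of p] p unfolding Mp_def by (intro tendsto_intros) auto
  then have lim: "(\<lambda>k. s / 2 * (Mp k / real k powr p - mp / real k powr p - 2 powr p)) \<longlonglongrightarrow> 0"
    by simp
  have "\<forall>\<^sub>F k in sequentially. enn2real (moment p (\<mu> k)) - enn2real (moment p (gauss :: 'a measure))
      - 2 powr (p - 1) * s * real k powr (p - t)
      = s / 2 * (Mp k / real k powr p - mp / real k powr p - 2 powr p) * real k powr (p - t)"
    using eventually_weight eventually_gt_at_top[of "0::nat"]
  proof eventually_elim
    case (elim k)
    have kp: "real k powr (p - t) = real k powr p * real k powr (- t)"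
      using elim by (simp flip: powr_add)
    have 2: "2 powr p = 2 * 2 powr (p - 1)"
      by (simp add: powr_diff)
    have w: "weight k = s / 2 * real k powr (- t)" using elim by simp
    have "enn2real (moment p (\<mu> k)) - enn2real (moment p (gauss :: 'a measure)) = weight k * (Mp k - mp)"
      using p by (simp add: moment_diff Mp_def mp_def)
    then show ?case
      using elim(2) by (simp only: w kp 2) (simp add: field_simps)
  qed
  moreover have "(\<lambda>k. s / 2 * (Mp k / real k powr p - mp / real k powr p - 2 powr p) * real k powr (p - t))
      \<in> o(\<lambda>k. real k powr (p - t))"
  proof (rule smalloI_tendsto)
    show "\<forall>\<^sub>F k in sequentially. real k powr (p - t) \<noteq> 0"
      using eventually_gt_at_top[of "0::nat"] by eventually_elim simp
    show "(\<lambda>k. s / 2 * (Mp k / real k powr p - mp / real k powr p - 2 powr p) * real k powr (p - t)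
        / real k powr (p - t)) \<longlonglongrightarrow> 0"
      by (rule Lim_transform_eventually[OF lim])
        (use eventually_gt_at_top[of "0::nat"] in eventually_elim, simp)
  qed
  ultimately show ?thesis
    by (rule landau_o.small.in_cong[THEN iffD2])
qed

text \<open>For p >= 1 one has 1 <= 2^(p-1) <= 2^(2(p-1)), so the error of the exact expansion
  serves as both a and b.\<close>

lemma moment_bounds:
  assumes p: "p \<ge> 1"
  shows "\<exists>a b :: nat \<Rightarrow> real. a \<in> o(\<lambda>k. real k powr (p - t)) \<and> b \<in> o(\<lambda>k. real k powr (p - t)) \<and>
    (\<forall>\<^sub>F k in sequentially.
      s * real k powr (p - t) + a k
        \<le> enn2real (moment p (\<mu> k)) - enn2real (moment p (gauss :: 'a measure)) \<and>
      enn2real (moment p (\<mu> k)) - enn2real (moment p (gauss :: 'a measure))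
        \<le> 2 powr (2 * (p - 1)) * s * real k powr (p - t) + b k)"
proof -
  let ?d = "\<lambda>k. enn2real (moment p (\<mu> k)) - enn2real (moment p (gauss :: 'a measure))
      - 2 powr (p - 1) * s * real k powr (p - t)"
  have "1 * (s * real k powr (p - t)) \<le> 2 powr (p - 1) * (s * real k powr (p - t))"
    "2 powr (p - 1) * (s * real k powr (p - t)) \<le> 2 powr (2 * (p - 1)) * (s * real k powr (p - t))" for k
    using s p by (intro mult_right_mono; simp add: ge_one_powr_ge_zero)+
  then show ?thesis
    using moment_asymptotics[OF p] by (intro exI[of _ ?d] conjI) (auto simp: mult.assoc)
qed

end

theorem lemma1p13:
  fixes s t :: real
  assumes "s > 0" and "t > 0"
  shows "\<exists>\<mu> :: nat \<Rightarrow> (real ^ 'n) measure.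
    (\<forall>k. gauss_prob (\<mu> k) \<and> centered (\<mu> k) \<and>
         fisher_information (\<mu> k) < \<infinity> \<and> finite_entropy (\<mu> k) \<and> W2 (\<mu> k) gauss < \<infinity> \<and>
         (\<forall>p\<ge>1. moment p (\<mu> k) < \<infinity>)) \<and>
    (\<lambda>k. deficit (\<mu> k) - s * t / 2 * real k powr (- t) * ln (real k))
      \<in> o(\<lambda>k. real k powr (- t) * ln (real k)) \<and>
    (\<lambda>k. entropy (\<mu> k) - (s * real k powr (2 - t) - s * t / 2 * real k powr (- t) * ln (real k)))
      \<in> o(\<lambda>k. real k powr (- t) * ln (real k)) \<and>
    (\<lambda>k. (enn2real (W2 (\<mu> k) gauss))\<^sup>2 - 2 * s * real k powr (2 - t))
      \<in> O(\<lambda>k. real k powr (1 - t) * sqrt (ln (real k))) \<and>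
    (\<lambda>k. (enn2real (moment 2 (\<mu> k)) - enn2real (moment 2 (gauss :: (real ^ 'n) measure)))
        - (2 * s * real k powr (2 - t)
           + s / 4 * enn2real (moment 2 (gauss :: (real ^ 'n) measure)) * real k powr (- t)))
      \<in> o(\<lambda>k. real k powr (- t)) \<and>
    (\<forall>p\<ge>1. \<exists>a b :: nat \<Rightarrow> real.
       a \<in> o(\<lambda>k. real k powr (p - t)) \<and> b \<in> o(\<lambda>k. real k powr (p - t)) \<and>
       (\<forall>\<^sub>F k in sequentially.
          s * real k powr (p - t) + a k
            \<le> enn2real (moment p (\<mu> k)) - enn2real (moment p (gauss :: (real ^ 'n) measure)) \<and>
          enn2real (moment p (\<mu> k)) - enn2real (moment p (gauss :: (real ^ 'n) measure))
            \<le> 2 powr (2 * (p - 1)) * s * real k powr (p - t) + b k))"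
proof -
  \<comment> \<open>The dimension is at least 1 because index types are nonempty; this provides a
    unit vector to translate along.\<close>
  obtain e :: "real ^ 'n" where "e \<in> Basis" using nonempty_Basis by blast
  then interpret mixture_sequence s t e
    using assms by unfold_locales auto
  show ?thesis
  proof (rule exI[of _ \<mu>], intro conjI allI impI)
    fix k :: nat and p :: real
    interpret gauss_mixture "weight k" "shift k" by (rule gauss_mixture)
    show "gauss_prob (\<mu> k)" "centered (\<mu> k)" "fisher_information (\<mu> k) < \<infinity>"
      "finite_entropy (\<mu> k)" "W2 (\<mu> k) gauss < \<infinity>"
      by (rule gauss_prob_mix centered_mix fisher_information_mix_finite finite_entropy_mix
          W2_mix_finite)+
    show "moment p (\<mu> k) < \<infinity>" if "1 \<le> p"
      using that by (simp add: moment_mix)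
  qed (rule deficit_asymptotics entropy_asymptotics W2_asymptotics second_moment_asymptotics
      moment_bounds, assumption?)+
qed

end
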